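(* Let $N\ge1$ be an integer and let $k_1,k_2,k_3\in\mathbb R$ with $k_3>0$, $k_2>-1/2$, and $k_1+k_2>-1/2$. Let $X=(X_1,\ldots,X_N)$ be an $A_N$-valued random variable with Lebesgue density $$c_{k_1,k_2,k_3}\prod_{i=1}^N\bigl((1-x_i)^{k_1+k_2-1/2}(1+x_i)^{k_2-1/2}\bigr)\prod_{1\le i<j\le N}|x_i-x_j|^{2k_3}\qquad (x\in A_N),$$ where $c_{k_1,k_2,k_3}>0$ is the normalization constant. Put $$\alpha=\frac{1+2k_1+2k_2}{2k_3}-1>-1,\qquad \beta=\frac{1+2k_2}{2k_3}-1>-1.$$ Then $$\mathbb E\Bigl(\prod_{i=1}^N(y-X_i)\Bigr)=\frac1{l_N^{(\alpha,\beta)}}\cdot P_N^{(\alpha,\beta)}(y)\qquad\text{for } y\in\mathbb R,$$ where $P_N^{(\alpha,\beta)}$ is the Jacobi polynomial and $l_N^{(\alpha,\beta)}$ its leading coefficient. Moreover, for $n=0,1,\ldots,N$, $$\mathbb E\bigl(e_n^N(X)\bigr)=\frac{2^N}{\binom{2N+\alpha+\beta}{N}}\sum_{l=N-n}^N(-1)^{N-l}\binom Nl\binom l{N-n}\frac{(N+\alpha+\beta+1)_l\,(\alpha+l+1)_{N-l}}{N!\,2^l}.$$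
   Context: $A_N:=\{x\in\mathbb R^N:\ -1\le x_1\le\ldots\le x_N\le 1\}$. $(a)_k=a(a+1)\cdots(a+k-1)$ is the Pochhammer symbol, and binomial coefficients with real upper entry are the generalized ones. The elementary symmetric polynomials $e_j^m$ in $m$ variables are given by $\prod_{j=1}^m(z-x_j)=\sum_{j=0}^m(-1)^{m-j}e_{m-j}^m(x)z^j$. Jacobi polynomials: for $\alpha,\beta>-1$, $$P_n^{(\alpha,\beta)}(x)=\sum_{k=0}^n\binom nk\frac{(n+\alpha+\beta+1)_k(\alpha+k+1)_{n-k}}{n!}\Bigl(\frac{x-1}2\Bigr)^k,$$ orthogonal with respect to the weight $(1-x)^\alpha(1+x)^\beta$ on $]-1,1[$. *)

theory Defs
  imports "HOL-Probability.Probability" "HOL-Computational_Algebra.Polynomial"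
begin

text \<open>Vectors in \<open>\<real>\<^sup>N\<close> are functions on \<open>{1..N}\<close>, extensional outside this index
  set, i.e. points of the product measure space \<open>PiM {1..N} (\<lambda>_. lborel)\<close>, whose measure is
  \<open>N\<close>-dimensional Lebesgue measure.\<close>

definition ordered_cube :: "nat \<Rightarrow> (nat \<Rightarrow> real) set" where
  "ordered_cube N = {x \<in> extensional {1..N}.
     -1 \<le> x 1 \<and> (\<forall>i\<in>{1..<N}. x i \<le> x (i + 1)) \<and> x N \<le> 1}"

text \<open>The polynomial is in the variable \<open>z\<close> of the generating identity
  \<open>elem_sym_generating\<close> below, which determines \<open>elem_sym\<close> for \<open>j \<le> m\<close>.\<close>

definition elem_sym :: "nat \<Rightarrow> nat \<Rightarrow> (nat \<Rightarrow> real) \<Rightarrow> real" where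
  "elem_sym m j x =
     (if j \<le> m then (-1) ^ j * coeff (\<Prod>i=1..m. [:- x i, 1:]) (m - j) else 0)"

lemma degree_prod_linear_le:
  fixes x :: "nat \<Rightarrow> real"
  shows "degree (\<Prod>i=1..m. [:- x i, 1:]) \<le> m"
proof -
  have "degree (\<Prod>i=1..m. [:- x i, 1:]) \<le> (\<Sum>i=1..m. degree [:- x i, 1:])"
    using degree_prod_sum_le[of "{1..m}" "\<lambda>i. [:- x i, 1:]"] by (simp add: o_def)
  then show ?thesis by simp
qed

lemma elem_sym_generating:
  "(\<Prod>j=1..m. (z - x j)) = (\<Sum>j=0..m. (-1) ^ (m - j) * elem_sym m (m - j) x * z ^ j)"
proof -
  let ?p = "\<Prod>i=1..m. [:- x i, 1:]"
  have "(\<Prod>j=1..m. (z - x j)) = poly ?p z"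
    by (simp add: poly_prod)
  also have "\<dots> = (\<Sum>j\<le>m. coeff ?p j * z ^ j)"
    unfolding poly_altdef using degree_prod_linear_le[of x m]
    by (intro sum.mono_neutral_left) (auto simp: coeff_eq_0)
  also have "\<dots> = (\<Sum>j=0..m. (-1) ^ (m - j) * elem_sym m (m - j) x * z ^ j)"
    by (rule sum.cong)
       (auto simp: elem_sym_def mult.assoc[symmetric] power_mult_distrib[symmetric])
  finally show ?thesis .
qed

definition jacobi_poly :: "nat \<Rightarrow> real \<Rightarrow> real \<Rightarrow> real poly" where
  "jacobi_poly n \<alpha> \<beta> = (\<Sum>k=0..n.
     smult (real (n choose k)
             * (pochhammer (real n + \<alpha> + \<beta> + 1) k * pochhammer (\<alpha> + real k + 1) (n - k)
                / fact n))
       ([:- 1 / 2, 1 / 2:] ^ k))"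

lemma poly_jacobi_poly:
  "poly (jacobi_poly n \<alpha> \<beta>) x = (\<Sum>k=0..n. real (n choose k)
     * (pochhammer (real n + \<alpha> + \<beta> + 1) k * pochhammer (\<alpha> + real k + 1) (n - k) / fact n)
     * ((x - 1) / 2) ^ k)"
  by (simp add: jacobi_poly_def poly_sum diff_divide_distrib)

text \<open>The weight before normalization. With \<open>0 powr a = 0\<close>, it vanishes where
  \<open>x i = 1\<close> or \<open>x i = -1\<close> for some \<open>i\<close>; this is a Lebesgue null set.\<close>

definition jacobi_weight :: "nat \<Rightarrow> real \<Rightarrow> real \<Rightarrow> real \<Rightarrow> (nat \<Rightarrow> real) \<Rightarrow> real" where
  "jacobi_weight N k1 k2 k3 x =
     (\<Prod>i=1..N. (1 - x i) powr (k1 + k2 - 1 / 2) * (1 + x i) powr (k2 - 1 / 2))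
     * (\<Prod>i=1..N. \<Prod>j\<in>{i<..N}. \<bar>x i - x j\<bar> powr (2 * k3))"

end

theory Submission
  imports Defs
begin

text \<open>Let \<open>w\<close> be the density and \<open>p(y) = \<Prod>i. (y - x i)\<close>. The vector field with components
  \<open>(1 - (x i)\<^sup>2) * p(y) / (y - x i)\<close>, multiplied by \<open>w\<close>, vanishes on the boundary of the chamber, so
  the integral of its divergence is \<open>0\<close>. Each component of the field has a factor that is independent
  of \<open>x i\<close>, and after symmetrization of the terms \<open>1 / (x i - x j)\<close> the divergence becomes \<open>w\<close> times
  a second order differential operator in \<open>y\<close> applied to \<open>p\<close>. Hence the polynomial
  \<open>\<^bold>E (\<Prod>i. (y - X i))\<close> satisfies the Jacobi differential equation, whose monic polynomial
  solution of degree \<open>N\<close> is unique.\<close>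

section \<open>One-dimensional integrals\<close>

text \<open>The exponents \<open>a\<close> and \<open>b\<close> of the weight may lie in ]-1, 0[, so
  \<open>w\<close> itself can blow up where \<open>x i\<close> is 1 or -1. The factor
  \<open>1 - (x i)\<^sup>2\<close> raises them to \<open>a + 1\<close> and \<open>b + 1\<close>,
  which are positive, and on the walls \<open>x i = x j\<close> the exponent
  \<open>g = 2 * k3\<close> is positive; this is why the boundary terms vanish. The obstacle is
  Fubini: for \<open>g < 1\<close> the divergence still has singularities of type
  \<open>\<bar>x i - x j\<bar> powr (g - 1)\<close>, so its integrability needs an argument of its
  own. Integrability of \<open>w\<close> comes with the existence of the density, and the value of
  the constant \<open>c\<close> never enters. The operator is \<open>k3\<close> times the Jacobi
  operator because \<open>a + 1 = k3 * (\<alpha> + 1)\<close> and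
  \<open>b + 1 = k3 * (\<beta> + 1)\<close>. Uniqueness rests on the expansion in powers of
  \<open>y - 1\<close>: it turns the equation into a two-term recurrence, in which
  \<open>(N - k) * (N + k + \<alpha> + \<beta> + 1)\<close> is nonzero for \<open>k < N\<close>, so
  the leading coefficient determines all others.\<close>

lemma has_real_derivative_prod_abs_powr:
  fixes c e :: "'i \<Rightarrow> real" and s :: real
  assumes "finite K" and "\<And>k. k \<in> K \<Longrightarrow> s \<noteq> c k"
  shows "((\<lambda>s. \<Prod>k\<in>K. \<bar>s - c k\<bar> powr e k) has_real_derivative
    (\<Prod>k\<in>K. \<bar>s - c k\<bar> powr e k) * (\<Sum>k\<in>K. e k / (s - c k))) (at s)"
  using assms
proof (induction K)
  case (insert m K)
  have sm: "s \<noteq> c m" using insert by auto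
  \<comment> \<open>Near \<open>s\<close> the absolute value has a fixed sign. Written as value
    times logarithmic derivative, the result is the same on both sides of \<open>c m\<close>,
    because the denominator \<open>s - c m\<close> carries the sign.\<close>
  have "((\<lambda>s. \<bar>s - c m\<bar> powr e m) has_real_derivative
      \<bar>s - c m\<bar> powr e m * (e m / (s - c m))) (at s)"
  proof (cases "s > c m")
    case True
    have "((\<lambda>s. (s - c m) powr e m) has_real_derivative
      (s - c m) powr e m * (e m / (s - c m))) (at s)"
      using True by (auto intro!: derivative_eq_intros simp: powr_diff)
    then have "((\<lambda>s. \<bar>s - c m\<bar> powr e m) has_real_derivative
      (s - c m) powr e m * (e m / (s - c m))) (at s)"
      by (rule has_field_derivative_transform_within_open[where S = "{c m<..}"]) (use True in auto)
    then show ?thesis using True by simp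
  next
    case False
    then have lt: "s < c m" using sm by simp
    have "((\<lambda>s. (c m - s) powr e m) has_real_derivative
      (c m - s) powr e m * (e m / (s - c m))) (at s)"
      using lt by (auto intro!: derivative_eq_intros simp: powr_diff field_simps)
    then have "((\<lambda>s. \<bar>s - c m\<bar> powr e m) has_real_derivative
      (c m - s) powr e m * (e m / (s - c m))) (at s)"
      by (rule has_field_derivative_transform_within_open[where S = "{..<c m}"]) (use lt in auto)
    then show ?thesis using lt by (simp add: abs_if)
  qed
  from DERIV_mult[OF this insert.IH] insert show ?case
    by (simp add: algebra_simps)
qed simp

lemma has_integral_indicator_mult_UNIV:
  fixes f :: "real \<Rightarrow> real"
  shows "((\<lambda>x. indicator S x * f x) has_integral I) UNIV \<longleftrightarrow> (f has_integral I) S"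
proof -
  have "(\<lambda>x. indicator S x * f x) = (\<lambda>x. if x \<in> S then f x else 0)"
    by (auto simp: indicator_def)
  then show ?thesis by (simp only: has_integral_restrict_UNIV)
qed

text \<open>The integrand is the derivative of the product on an open interval free of the points
  \<open>c k\<close>. Positive exponents make the product continuous up to \<open>l\<close> and
  \<open>u\<close>, where it vanishes since both are among the \<open>c k\<close>; the fundamental
  theorem of calculus then gives 0.\<close>

lemma integral_derivative_prod_abs_powr:
  fixes c e :: "'i \<Rightarrow> real" and l u :: real
  assumes "finite K" and pos: "\<And>k. k \<in> K \<Longrightarrow> e k > 0"
    and out: "\<And>k. k \<in> K \<Longrightarrow> c k \<notin> {l<..<u}"
    and l: "l \<in> c ` K" and u: "u \<in> c ` K"
  shows "(LINT s|lborel. indicator {l<..<u} s *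
    ((\<Prod>k\<in>K. \<bar>s - c k\<bar> powr e k) * (\<Sum>k\<in>K. e k / (s - c k)))) = 0"
proof (cases "l < u \<and> integrable lborel (\<lambda>s. indicator {l<..<u} s *
    ((\<Prod>k\<in>K. \<bar>s - c k\<bar> powr e k) * (\<Sum>k\<in>K. e k / (s - c k))))")
  case True
  define g where "g = (\<lambda>s. \<Prod>k\<in>K. \<bar>s - c k\<bar> powr e k)"
  define g' where "g' = (\<lambda>s. g s * (\<Sum>k\<in>K. e k / (s - c k)))"
  have int: "integrable lborel (\<lambda>s. indicator {l<..<u} s * g' s)"
    using True by (simp add: g'_def g_def)
  have "(g' has_integral g u - g l) {l..u}"
  proof (rule fundamental_theorem_of_calculus_interior)
    show "continuous_on {l..u} g"
      unfolding g_def by (intro continuous_on_prod continuous_on_powr' continuous_intros) (auto dest: pos)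
    show "(g has_vector_derivative g' x) (at x)" if "x \<in> {l<..<u}" for x
      unfolding g_def g'_def has_real_derivative_iff_has_vector_derivative[symmetric]
      by (rule has_real_derivative_prod_abs_powr) (use assms that in auto)
  qed (use True in simp)
  moreover have "g u = 0" "g l = 0"
    unfolding g_def using u l \<open>finite K\<close> by (auto intro!: prod_zero)
  ultimately have "(g' has_integral 0) {l..u}" by simp
  then have "(g' has_integral 0) {l<..<u}"
    using has_integral_open_interval[of g' 0 l u] by simp
  then have "((\<lambda>s. indicator {l<..<u} s * g' s) has_integral 0) UNIV"
    by (simp only: has_integral_indicator_mult_UNIV)
  with has_integral_integral_lborel[OF int] show ?thesis
    by (simp add: g_def g'_def has_integral_unique)
next
  case False
  then show ?thesis
  proof (cases "l < u")
    case True
    \<comment> \<open>The Bochner integral of a non-integrable function is 0 by convention.\<close>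
    with False show ?thesis by (intro not_integrable_integral_eq) auto
  qed (auto)
qed

text \<open>For \<open>x\<close> and \<open>y\<close> in [-1, 1] the difference lies in [-2, 2], so
  each side of \<open>y\<close> contributes at most the integral of \<open>t powr s\<close> over
  [0, 2]. Uniformity in \<open>y\<close> is the point: with \<open>s = g - 1\<close> the bound
  serves as the inner estimate in Tonelli's theorem, and with \<open>y = 1\<close> and
  \<open>y = -1\<close> it controls the endpoint singularities.\<close>

lemma nn_integral_abs_diff_powr_bounded:
  fixes s :: real
  assumes "s > -1"
  obtains K :: real where "K \<ge> 0" and "\<And>y. y \<in> {-1..1} \<Longrightarrow>
    (\<integral>\<^sup>+x. ennreal (indicator {-1..1} x * \<bar>x - y\<bar> powr s) \<partial>lborel) \<le> ennreal K"
proof -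
  have half: "(\<integral>\<^sup>+x. ennreal (indicator {0..2} x * x powr s) \<partial>lborel) = ennreal (2 powr (s+1) / (s+1))"
  proof (rule nn_integral_has_integral_lborel)
    show "((\<lambda>x. indicator {0..2} x * x powr s) has_integral 2 powr (s + 1) / (s + 1)) UNIV"
      using has_integral_powr_from_0[OF assms, of 2]
      by (simp only: has_integral_indicator_mult_UNIV)
  qed auto
  define C where "C = 2 powr (s+1) / (s+1)"
  have C: "C \<ge> 0" using assms by (simp add: C_def)
  show ?thesis
  proof (rule that[of "C + C"])
    fix y :: real assume y: "y \<in> {-1..1}"
    have "(\<integral>\<^sup>+x. ennreal (indicator {-1..1} x * \<bar>x - y\<bar> powr s) \<partial>lborel)
      \<le> (\<integral>\<^sup>+x. ennreal (indicator {0..2} (x - y) * (x - y) powr s) + ennreal (indicator {0..2} (y - x) * (y - x) powr s) \<partial>lborel)"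
      using y by (intro nn_integral_mono) (auto simp: indicator_def)
    also have "\<dots> = (\<integral>\<^sup>+x. ennreal (indicator {0..2} (x - y) * (x - y) powr s) \<partial>lborel)
        + (\<integral>\<^sup>+x. ennreal (indicator {0..2} (y - x) * (y - x) powr s) \<partial>lborel)"
      by (intro nn_integral_add) auto
    also have "(\<integral>\<^sup>+x. ennreal (indicator {0..2} (x - y) * (x - y) powr s) \<partial>lborel) = ennreal C"
      unfolding C_def half[symmetric]
      by (subst nn_integral_real_affine[of _ 1 y]) auto
    also have "(\<integral>\<^sup>+x. ennreal (indicator {0..2} (y - x) * (y - x) powr s) \<partial>lborel) = ennreal C"
      unfolding C_def half[symmetric]
      by (subst nn_integral_real_affine[of _ "-1" y]) auto
    finally show "(\<integral>\<^sup>+x. ennreal (indicator {-1..1} x * \<bar>x - y\<bar> powr s) \<partial>lborel) \<le> ennreal (C + C)"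
      by (simp only: ennreal_plus[OF C C])
  qed (use C in simp)
qed

section \<open>The divergence on the open chamber\<close>

text \<open>The index set is a parameter, rather than {1..N}, so that a single coordinate can be
  split off for Fubini.\<close>

definition vandermonde_powr :: "real \<Rightarrow> nat set \<Rightarrow> (nat \<Rightarrow> real) \<Rightarrow> real" where
  "vandermonde_powr g I x = (\<Prod>i\<in>I. \<Prod>j\<in>{j\<in>I. i < j}. \<bar>x i - x j\<bar> powr g)"

definition beta_weight :: "real \<Rightarrow> real \<Rightarrow> real \<Rightarrow> real" where
  "beta_weight a b s = (1 - s) powr a * (1 + s) powr b"

definition selberg_weight :: "real \<Rightarrow> real \<Rightarrow> real \<Rightarrow> nat set \<Rightarrow> (nat \<Rightarrow> real) \<Rightarrow> real" where
  "selberg_weight a b g I x = (\<Prod>i\<in>I. beta_weight a b (x i)) * vandermonde_powr g I x"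

text \<open>Coordinates outside \<open>I\<close> are unconstrained, so membership of
  \<open>x(i := s)\<close> separates into conditions on the other coordinates and an interval for
  \<open>s\<close>. The strict inequalities keep all differences \<open>x i - x j\<close>
  nonzero.\<close>

definition open_chamber :: "nat set \<Rightarrow> (nat \<Rightarrow> real) set" where
  "open_chamber I = {x. (\<forall>i\<in>I. -1 < x i \<and> x i < 1) \<and> (\<forall>i\<in>I. \<forall>j\<in>I. i < j \<longrightarrow> x i < x j)}"

text \<open>With \<open>w = selberg_weight a b g I\<close> this is
  \<open>\<partial>\<^sub>i ((1 - (x i)\<^sup>2) * w x * (\<Prod>j\<in>I-{i}. y - x j)) / w x\<close>.\<close>

definition chamber_divergence ::
  "real \<Rightarrow> real \<Rightarrow> real \<Rightarrow> nat set \<Rightarrow> real \<Rightarrow> nat \<Rightarrow> (nat \<Rightarrow> real) \<Rightarrow> real" where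
  "chamber_divergence a b g I y i x = (\<Prod>j\<in>I-{i}. y - x j) *
     ((b + 1) * (1 - x i) - (a + 1) * (1 + x i)
       + (\<Sum>j\<in>I-{i}. g * (1 - (x i)\<^sup>2) / (x i - x j)))"

text \<open>The pairs containing \<open>m\<close> come in two kinds, with \<open>m\<close> as the
  smaller or as the larger index; the symmetry of the absolute value merges both into one product
  over \<open>J\<close>.\<close>

lemma vandermonde_powr_insert:
  assumes "finite J" and "m \<notin> J"
  shows "vandermonde_powr g (insert m J) x
    = vandermonde_powr g J x * (\<Prod>j\<in>J. \<bar>x m - x j\<bar> powr g)"
proof -
  let ?d = "\<lambda>i j. \<bar>x i - x j\<bar> powr g"
  have 1: "{j \<in> insert m J. m < j} = {j\<in>J. m < j}" using assms by auto
  have 2: "(\<Prod>j\<in>{j \<in> insert m J. i < j}. ?d i j)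
      = (if i < m then ?d m i else 1) * (\<Prod>j\<in>{j\<in>J. i < j}. ?d i j)" if "i \<in> J" for i
  proof -
    have "{j \<in> insert m J. i < j} = (if i < m then insert m {j\<in>J. i < j} else {j\<in>J. i < j})"
      by auto
    with assms show ?thesis by (auto simp: abs_minus_commute)
  qed
  have 3: "(\<Prod>j\<in>{j\<in>J. m < j}. ?d m j) * (\<Prod>i\<in>J. if i < m then ?d m i else 1) = (\<Prod>j\<in>J. ?d m j)"
    unfolding prod.inter_filter[OF \<open>finite J\<close>] prod.distrib[symmetric]
    using assms by (intro prod.cong) auto
  have "vandermonde_powr g (insert m J) x = (\<Prod>j\<in>{j\<in>J. m < j}. ?d m j) *
      (\<Prod>i\<in>J. (if i < m then ?d m i else 1) * (\<Prod>j\<in>{j\<in>J. i < j}. ?d i j))"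
    unfolding vandermonde_powr_def prod.insert[OF assms] by (simp only: 1 2 cong: prod.cong)
  also have "\<dots> = ((\<Prod>j\<in>{j\<in>J. m < j}. ?d m j) * (\<Prod>i\<in>J. if i < m then ?d m i else 1))
      * vandermonde_powr g J x"
    by (simp add: prod.distrib vandermonde_powr_def)
  finally show ?thesis unfolding 3 by simp
qed

lemma vandermonde_powr_cong:
  "(\<And>j. j \<in> J \<Longrightarrow> x j = z j) \<Longrightarrow> vandermonde_powr g J x = vandermonde_powr g J z"
  unfolding vandermonde_powr_def by (intro prod.cong) auto

lemma vandermonde_powr_nonneg: "vandermonde_powr g J x \<ge> 0"
  unfolding vandermonde_powr_def by (intro prod_nonneg ballI) auto

lemma beta_weight_nonneg: "beta_weight a b s \<ge> 0"
  by (simp add: beta_weight_def)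

lemma prod_le_power_card:
  fixes f :: "'i \<Rightarrow> real"
  assumes "\<And>i. i \<in> A \<Longrightarrow> 0 \<le> f i \<and> f i \<le> m"
  shows "(\<Prod>i\<in>A. f i) \<le> m ^ card A"
  using prod_mono[of A f "\<lambda>_. m"] assms by simp

lemma vandermonde_powr_le:
  assumes "g > 0" and "finite J" and "x \<in> open_chamber J"
  shows "vandermonde_powr g J x \<le> (2 powr g) ^ (card J * card J)"
proof -
  \<comment> \<open>A base of at least 1 permits overestimating the number of pairs by
    \<open>card J * card J\<close>.\<close>
  have g1: "1 \<le> 2 powr g" using assms by (simp add: ge_one_powr_ge_zero)
  have "(\<Prod>j\<in>{j\<in>J. i < j}. \<bar>x i - x j\<bar> powr g) \<le> (2 powr g) ^ card J" if i: "i \<in> J" for i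
  proof -
    have "(\<Prod>j\<in>{j\<in>J. i < j}. \<bar>x i - x j\<bar> powr g) \<le> (2 powr g) ^ card {j\<in>J. i < j}"
    proof (intro prod_le_power_card conjI powr_mono2)
      fix j assume "j \<in> {j\<in>J. i < j}"
      with assms(3) i have "-1 < x i" "x i < 1" "-1 < x j" "x j < 1"
        by (auto simp: open_chamber_def)
      then show "\<bar>x i - x j\<bar> \<le> 2" by (simp add: abs_le_iff)
    qed (use assms in auto)
    also have "\<dots> \<le> (2 powr g) ^ card J"
      using assms by (intro power_increasing g1 card_mono) auto
    finally show ?thesis .
  qed
  then have "vandermonde_powr g J x \<le> ((2 powr g) ^ card J) ^ card J"
    unfolding vandermonde_powr_def
    by (intro prod_le_power_card conjI prod_nonneg) auto
  then show ?thesis by (simp add: power_mult)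
qed

lemma selberg_weight_insert:
  assumes "finite J" and "i \<notin> J"
  shows "selberg_weight a b g (insert i J) (x(i := s)) = selberg_weight a b g J x *
    (beta_weight a b s * (\<Prod>j\<in>J. \<bar>s - x j\<bar> powr g))"
proof -
  have "vandermonde_powr g J (x(i := s)) = vandermonde_powr g J x"
    using assms by (intro vandermonde_powr_cong) auto
  moreover have "(\<Prod>j\<in>J. beta_weight a b ((x(i := s)) j)) = (\<Prod>j\<in>J. beta_weight a b (x j))"
    using assms by (intro prod.cong) auto
  moreover have "(\<Prod>j\<in>J. \<bar>s - (x(i := s)) j\<bar> powr g) = (\<Prod>j\<in>J. \<bar>s - x j\<bar> powr g)"
    using assms by (intro prod.cong) auto
  ultimately show ?thesis
    using assms by (simp add: selberg_weight_def vandermonde_powr_insert)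
qed

section \<open>Integration along one coordinate\<close>

lemma open_chamber_insert_iff:
  assumes "i \<notin> J"
  shows "x(i := s) \<in> open_chamber (insert i J) \<longleftrightarrow> x \<in> open_chamber J \<and> -1 < s \<and> s < 1
    \<and> (\<forall>j\<in>J. j < i \<longrightarrow> x j < s) \<and> (\<forall>j\<in>J. i < j \<longrightarrow> s < x j)"
  using assms unfolding open_chamber_def by (auto split: if_splits)

text \<open>With the other coordinates fixed, the slice of the chamber is an interval whose ends are
  neighbouring coordinates or the endpoints -1 and 1. On it the integrand is a constant times the
  derivative of a product of powers of distances to the fixed coordinates and to -1 and 1, so
  \<open>integral_derivative_prod_abs_powr\<close> applies.\<close>

lemma integral_chamber_divergence_slice:
  assumes fin: "finite J" and i: "i \<notin> J" and "g > 0" and "a > -1" and "b > -1"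
  shows "(LINT s|lborel. indicator (open_chamber (insert i J)) (x(i := s))
    * (selberg_weight a b g (insert i J) (x(i := s))
    * chamber_divergence a b g (insert i J) y i (x(i := s)))) = 0"
proof (cases "x \<in> open_chamber J")
  case False
  then show ?thesis by (simp add: indicator_def open_chamber_insert_iff[OF i])
next
  case True
  define l where "l = Max (insert (-1) (x ` {j\<in>J. j < i}))"
  define u where "u = Min (insert 1 (x ` {j\<in>J. i < j}))"
  have fin': "finite (insert (-1) (x ` {j\<in>J. j < i}))" "finite (insert 1 (x ` {j\<in>J. i < j}))"
    using fin by auto
  \<comment> \<open>The zeros of the product: \<open>Inl j\<close> stands for the coordinate
    \<open>x j\<close> with exponent \<open>g\<close>, \<open>Inr True\<close> for 1 and
    \<open>Inr False\<close> for -1. A tagged index keeps the exponents separate even if the points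
    should coincide.\<close>
  define K :: "(nat + bool) set" where "K = Inl ` J \<union> {Inr True, Inr False}"
  define c :: "nat + bool \<Rightarrow> real" where "c = case_sum x (\<lambda>t. if t then 1 else -1)"
  define e :: "nat + bool \<Rightarrow> real" where "e = case_sum (\<lambda>_. g) (\<lambda>t. if t then a + 1 else b + 1)"
  have slice: "x(i := s) \<in> open_chamber (insert i J) \<longleftrightarrow> s \<in> {l<..<u}" for s
    using True fin' by (auto simp: open_chamber_insert_iff[OF i] l_def u_def)
  define C where "C = (\<Prod>j\<in>J. y - x j) * selberg_weight a b g J x"
  have "indicator (open_chamber (insert i J)) (x(i := s))
    * (selberg_weight a b g (insert i J) (x(i := s))
    * chamber_divergence a b g (insert i J) y i (x(i := s)))
    = C * (indicator {l<..<u} s * ((\<Prod>k\<in>K. \<bar>s - c k\<bar> powr e k) * (\<Sum>k\<in>K. e k / (s - c k))))" for s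
  proof (cases "s \<in> {l<..<u}")
    case lu: True
    then have s: "-1 < s" "s < 1" using slice[of s] by (auto simp: open_chamber_insert_iff[OF i])
    have P: "(\<Prod>k\<in>K. \<bar>s - c k\<bar> powr e k) = (\<Prod>j\<in>J. \<bar>s - x j\<bar> powr g) *
        (\<bar>s - 1\<bar> powr (a + 1) * \<bar>s + 1\<bar> powr (b + 1))"
      unfolding K_def using fin
      by (subst prod.union_disjoint) (auto simp: prod.reindex c_def e_def)
    have S: "(\<Sum>k\<in>K. e k / (s - c k)) = (\<Sum>j\<in>J. g / (s - x j)) + ((a + 1) / (s - 1) + (b + 1) / (s + 1))"
      unfolding K_def using fin
      by (subst sum.union_disjoint) (auto simp: sum.reindex c_def e_def)
    \<comment> \<open>The factor \<open>1 - s\<^sup>2\<close> of the vector field accounts for the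
      shift of the endpoint exponents by one.\<close>
    have v: "\<bar>s - 1\<bar> powr (a + 1) * \<bar>s + 1\<bar> powr (b + 1) = beta_weight a b s * ((1 - s) * (1 + s))"
      using s by (simp add: beta_weight_def powr_add abs_if add.commute)
    have D: "chamber_divergence a b g (insert i J) y i (x(i := s)) = (\<Prod>j\<in>J. y - x j) *
       ((b + 1) * (1 - s) - (a + 1) * (1 + s) + (\<Sum>j\<in>J. g * (1 - s\<^sup>2) / (s - x j)))"
    proof -
      have "insert i J - {i} = J" using i by auto
      moreover have "(\<Prod>j\<in>J. y - (x(i := s)) j) = (\<Prod>j\<in>J. y - x j)"
        "(\<Sum>j\<in>J. g * (1 - s\<^sup>2) / (s - (x(i := s)) j)) = (\<Sum>j\<in>J. g * (1 - s\<^sup>2) / (s - x j))"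
        using i by (auto intro!: prod.cong sum.cong)
      ultimately show ?thesis by (simp add: chamber_divergence_def)
    qed
    have "(1 - s) * (1 + s) * ((\<Sum>j\<in>J. g / (s - x j)) + ((a + 1) / (s - 1) + (b + 1) / (s + 1)))
      = (b + 1) * (1 - s) - (a + 1) * (1 + s) + (\<Sum>j\<in>J. g * (1 - s\<^sup>2) / (s - x j))"
    proof -
      have "(1 - s) * (1 + s) * (\<Sum>j\<in>J. g / (s - x j)) = (\<Sum>j\<in>J. g * (1 - s\<^sup>2) / (s - x j))"
        by (simp add: sum_distrib_left power2_eq_square algebra_simps)
      moreover have "(1 - s) * (1 + s) * ((a + 1) / (s - 1)) = - (a + 1) * (1 + s)"
        using s by (simp add: field_simps)
      moreover have "(1 - s) * (1 + s) * ((b + 1) / (s + 1)) = (b + 1) * (1 - s)"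
        using s by (simp add: field_simps)
      ultimately show ?thesis by (simp only: distrib_left)
    qed
    note E = this[symmetric]
    show ?thesis
      using lu slice[of s]
      by (simp add: selberg_weight_insert[OF fin i] D E P S v C_def)
  qed (use slice[of s] in auto)
  then have "(LINT s|lborel. indicator (open_chamber (insert i J)) (x(i := s))
    * (selberg_weight a b g (insert i J) (x(i := s))
    * chamber_divergence a b g (insert i J) y i (x(i := s))))
    = C * (LINT s|lborel. indicator {l<..<u} s * ((\<Prod>k\<in>K. \<bar>s - c k\<bar> powr e k) * (\<Sum>k\<in>K. e k / (s - c k))))"
    by simp
  also have "(LINT s|lborel. indicator {l<..<u} s * ((\<Prod>k\<in>K. \<bar>s - c k\<bar> powr e k) * (\<Sum>k\<in>K. e k / (s - c k)))) = 0"
  proof (rule integral_derivative_prod_abs_powr)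
    show "finite K" using fin by (simp add: K_def)
    show "e k > 0" if "k \<in> K" for k
      using that assms by (auto simp: K_def e_def)
    show "c k \<notin> {l<..<u}" if "k \<in> K" for k
    proof -
      have "x j \<notin> {l<..<u}" if j: "j \<in> J" for j
      proof (cases "j < i")
        case True
        then have "x j \<le> l" unfolding l_def using j by (intro Max_ge fin') auto
        then show ?thesis by simp
      next
        case False
        then have "i < j" using i j by (metis linorder_neqE_nat)
        then have "u \<le> x j" unfolding u_def using j by (intro Min_le fin') auto
        then show ?thesis by simp
      qed
      moreover have "-1 \<le> l" "u \<le> 1" unfolding l_def u_def
        using fin' by (auto intro: Max_ge Min_le)
      ultimately show ?thesis using that by (auto simp: K_def c_def)
    qed
    have "l \<in> insert (-1) (x ` {j\<in>J. j < i})"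
      unfolding l_def by (rule Max_in) (use fin' in auto)
    moreover have "u \<in> insert 1 (x ` {j\<in>J. i < j})"
      unfolding u_def by (rule Min_in) (use fin' in auto)
    ultimately show "l \<in> c ` K" "u \<in> c ` K"
      by (auto simp: K_def c_def image_iff)
  qed
  finally show ?thesis by (simp only: mult_zero_right)
qed

section \<open>Measurability and integrability\<close>

lemma measurable_open_chamber [measurable]:
  assumes [simp]: "finite I"
  shows "Measurable.pred (PiM I (\<lambda>_. lborel)) (\<lambda>x. x \<in> open_chamber I)"
  unfolding open_chamber_def mem_Collect_eq by measurable

lemma measurable_selberg_weight [measurable]:
  assumes [simp]: "finite I"
  shows "selberg_weight a b g I \<in> borel_measurable (PiM I (\<lambda>_. lborel))"
  unfolding selberg_weight_def vandermonde_powr_def beta_weight_def by measurable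

lemma measurable_prod_beta_weight:
  assumes [simp]: "finite J"
  shows "(\<lambda>x. \<Prod>k\<in>J. indicator {-1<..<1} (x k) * beta_weight a b (x k))
    \<in> borel_measurable (PiM J (\<lambda>_. lborel))"
  unfolding beta_weight_def by measurable

text \<open>On each half of the interval only one of the two factors can be singular, while the base
  of the other lies in [1, 2]. The sum of the two pure power singularities is thus a majorant up to
  a constant.\<close>

lemma nn_integral_beta_weight_finite:
  assumes "a > -1" and "b > -1"
  shows "(\<integral>\<^sup>+s. ennreal (indicator {-1<..<1} s * beta_weight a b s) \<partial>lborel) < \<infinity>"
proof -
  obtain A where A: "A \<ge> 0" "\<And>y. y \<in> {-1..1} \<Longrightarrow>
    (\<integral>\<^sup>+x. ennreal (indicator {-1..1} x * \<bar>x - y\<bar> powr a) \<partial>lborel) \<le> ennreal A"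
    using nn_integral_abs_diff_powr_bounded[OF assms(1)] by blast
  obtain B where B: "B \<ge> 0" "\<And>y. y \<in> {-1..1} \<Longrightarrow>
    (\<integral>\<^sup>+x. ennreal (indicator {-1..1} x * \<bar>x - y\<bar> powr b) \<partial>lborel) \<le> ennreal B"
    using nn_integral_abs_diff_powr_bounded[OF assms(2)] by blast
  \<comment> \<open>On [1, 2] the power \<open>t powr e\<close> is monotone, so the larger of its
    endpoint values bounds it for either sign of \<open>e\<close>; adding the bounds for
    \<open>a\<close> and \<open>b\<close> gives one constant for both halves.\<close>
  define m where "m = max (2 powr a) 1 + max (2 powr b) 1"
  have m: "m \<ge> 0" by (simp add: m_def max.coboundedI2)
  have bound: "t powr e \<le> max (2 powr e) 1" if "1 \<le> t" "t \<le> 2" for t e :: real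
  proof (cases "e \<ge> 0")
    case True
    then show ?thesis using that powr_mono2[of e t 2] by simp
  next
    case False
    then show ?thesis using that powr_mono2'[of e 1 t] by simp
  qed
  have le: "indicator {-1<..<1} s * beta_weight a b s
     \<le> m * (indicator {-1..1} s * \<bar>s - 1\<bar> powr a) + m * (indicator {-1..1} s * \<bar>s - (-1)\<bar> powr b)" for s
  proof (cases "s \<in> {-1<..<1}")
    case True
    show ?thesis
    proof (cases "s \<ge> 0")
      case s: True
      have "(1 + s) powr b \<le> m"
        using bound[of "1 + s" b] True s by (auto simp: m_def intro: order_trans)
      then have "beta_weight a b s \<le> (1 - s) powr a * m"
        unfolding beta_weight_def by (intro mult_left_mono) auto
      moreover have "0 \<le> m * \<bar>s - (-1)\<bar> powr b" using m by simp
      ultimately show ?thesis using True by (simp add: mult.commute abs_if)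
    next
      case s: False
      have "(1 - s) powr a \<le> m"
        using bound[of "1 - s" a] True s by (auto simp: m_def intro: order_trans)
      then have "beta_weight a b s \<le> m * (1 + s) powr b"
        unfolding beta_weight_def by (intro mult_right_mono) auto
      moreover have "0 \<le> m * \<bar>s - 1\<bar> powr a" using m by simp
      ultimately show ?thesis using True by (simp add: abs_if add.commute)
    qed
  qed (use m in simp)
  have "(\<integral>\<^sup>+s. ennreal (indicator {-1<..<1} s * beta_weight a b s) \<partial>lborel)
    \<le> (\<integral>\<^sup>+s. ennreal m * ennreal (indicator {-1..1} s * \<bar>s - 1\<bar> powr a)
         + ennreal m * ennreal (indicator {-1..1} s * \<bar>s - (-1)\<bar> powr b) \<partial>lborel)"
  proof (rule nn_integral_mono)
    fix s
    show "ennreal (indicator {-1<..<1} s * beta_weight a b s)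
      \<le> ennreal m * ennreal (indicator {-1..1} s * \<bar>s - 1\<bar> powr a)
         + ennreal m * ennreal (indicator {-1..1} s * \<bar>s - (-1)\<bar> powr b)"
      using ennreal_leI[OF le[of s]] m by (simp add: ennreal_mult')
  qed
  also have "\<dots> = ennreal m * (\<integral>\<^sup>+s. ennreal (indicator {-1..1} s * \<bar>s - 1\<bar> powr a) \<partial>lborel)
     + ennreal m * (\<integral>\<^sup>+s. ennreal (indicator {-1..1} s * \<bar>s - (-1)\<bar> powr b) \<partial>lborel)"
    by (simp add: nn_integral_add nn_integral_cmult)
  also have "\<dots> \<le> ennreal m * ennreal A + ennreal m * ennreal B"
    by (intro add_mono mult_left_mono A B) auto
  also have "\<dots> < \<infinity>" by (simp add: ennreal_mult_less_top)
  finally show ?thesis .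
qed

text \<open>For exponents \<open>a\<close>, \<open>b\<close> near \<open>-1\<close> and small \<open>g\<close>, integrability near the corners
  \<open>x i = x j = \<plusminus>1\<close> needs the factor \<open>1 - (x i)\<^sup>2\<close>: it cancels the endpoint singularities in \<open>x i\<close>,
  so that the integral of \<open>\<bar>x i - x j\<bar> powr (g - 1)\<close> over \<open>x i\<close> is bounded uniformly in \<open>x j\<close>.\<close>

lemma integrable_singular_term:
  fixes F :: "(nat \<Rightarrow> real) \<Rightarrow> real"
  assumes fin: "finite J" and i: "i \<notin> J" and j: "j \<in> J" and g: "g > 0" and a: "a > -1" and b: "b > -1"
    and F [measurable]: "F \<in> borel_measurable (PiM (insert i J) (\<lambda>_. lborel))"
    and F_le: "\<And>x. x \<in> open_chamber (insert i J) \<Longrightarrow> \<bar>F x\<bar> \<le> B"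
  shows "integrable (PiM (insert i J) (\<lambda>_. lborel)) (\<lambda>x. indicator (open_chamber (insert i J)) x *
    (selberg_weight a b g (insert i J) x * (F x * ((1 - (x i)\<^sup>2) / (x i - x j)))))"
    (is "integrable _ ?f")
proof (rule integrableI_bounded)
  note [simp] = fin
  have [measurable]: "(\<lambda>x::nat \<Rightarrow> real. x j) \<in> borel_measurable (PiM (insert i J) (\<lambda>_. lborel))"
    using measurable_component_singleton[of j "insert i J" "\<lambda>_. lborel"] j by simp
  have [measurable]: "(\<lambda>x::nat \<Rightarrow> real. x i) \<in> borel_measurable (PiM (insert i J) (\<lambda>_. lborel))"
    using measurable_component_singleton[of i "insert i J" "\<lambda>_. lborel"] by simp
  interpret product_sigma_finite "\<lambda>_::nat. lborel :: real measure"
    by standard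
  have [measurable]: "(\<lambda>x. indicator (open_chamber (insert i J)) x :: real)
      \<in> borel_measurable (PiM (insert i J) (\<lambda>_. lborel))"
    using measurable_open_chamber[of "insert i J"] by (intro borel_measurable_indicator') simp_all
  show meas [measurable]: "?f \<in> borel_measurable (PiM (insert i J) (\<lambda>_. lborel))"
    by measurable
  define v where "v = beta_weight a b"
  have v0: "v s \<ge> 0" for s by (simp add: v_def beta_weight_nonneg)
  obtain K where K: "K \<ge> 0" "\<And>y. y \<in> {-1..1} \<Longrightarrow>
    (\<integral>\<^sup>+x. ennreal (indicator {-1..1} x * \<bar>x - y\<bar> powr (g - 1)) \<partial>lborel) \<le> ennreal K"
    using nn_integral_abs_diff_powr_bounded[of "g - 1"] g by auto
  \<comment> \<open>Collects the bounds for everything nonsingular in the slice variable: the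
    Vandermonde factor of \<open>J\<close>, the endpoint factors including
    \<open>1 - s\<^sup>2\<close>, the distances to coordinates other than \<open>x j\<close>, and
    \<open>F\<close>.\<close>
  define C where "C = (2 powr g) ^ (card J * card J) * ((2 powr (a + 1) * 2 powr (b + 1)) * (2 powr g) ^ card (J - {j}) * \<bar>B\<bar>)"
  have C0: "C \<ge> 0" by (simp add: C_def)
  \<comment> \<open>The majorant in the remaining coordinates is a product of functions of one
    variable, so its integral factorizes.\<close>
  define R where "R = (\<lambda>x. \<Prod>k\<in>J. indicator {-1<..<1} (x k) * v (x k))"
  have R0: "R x \<ge> 0" for x
    unfolding R_def by (intro prod_nonneg ballI mult_nonneg_nonneg v0) auto
  have bound: "\<bar>?f (x(i := s))\<bar> \<le> C * R x * (indicator {-1..1} s * \<bar>s - x j\<bar> powr (g - 1))" for x s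
  proof (cases "x(i := s) \<in> open_chamber (insert i J)")
    case True
    then have x: "x \<in> open_chamber J" and s: "-1 < s" "s < 1" and sj: "s \<noteq> x j"
      using i j by (auto simp: open_chamber_insert_iff[OF i]) (metis linorder_neqE_nat less_irrefl)
    have Rx: "R x = (\<Prod>k\<in>J. v (x k))"
      unfolding R_def using x by (intro prod.cong) (auto simp: open_chamber_def)
    have "\<bar>?f (x(i := s))\<bar> = selberg_weight a b g J x *
      (v s * (\<Prod>j\<in>J. \<bar>s - x j\<bar> powr g)) * (\<bar>F (x(i := s))\<bar> * ((1 - s\<^sup>2) / \<bar>s - x j\<bar>))"
    proof -
      define W where "W = selberg_weight a b g J x * (v s * (\<Prod>j\<in>J. \<bar>s - x j\<bar> powr g))"
      have "W \<ge> 0"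
        unfolding selberg_weight_def W_def
        by (intro mult_nonneg_nonneg prod_nonneg vandermonde_powr_nonneg v0 ballI beta_weight_nonneg) auto
      moreover have "1 - s\<^sup>2 \<ge> 0" using s by (simp add: abs_square_le_1 abs_le_iff)
      moreover have "?f (x(i := s)) = W * (F (x(i := s)) * ((1 - s\<^sup>2) / (s - x j)))"
        using True i j by (auto simp: selberg_weight_insert[OF fin i] v_def W_def)
      ultimately show ?thesis unfolding W_def[symmetric] by (simp add: abs_mult)
    qed
    \<comment> \<open>The two decisive regroupings: \<open>1 - s\<^sup>2\<close> joins
      \<open>v s\<close>, which becomes bounded, and the denominator lowers the exponent of
      \<open>\<bar>s - x j\<bar>\<close> from \<open>g\<close> to \<open>g - 1\<close>.\<close>
    also have "\<dots> = vandermonde_powr g J x * ((v s * (1 - s\<^sup>2)) * (\<Prod>k\<in>J - {j}. \<bar>s - x k\<bar> powr g) * \<bar>F (x(i := s))\<bar>)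
        * (R x * \<bar>s - x j\<bar> powr (g - 1))"
      using sj by (simp add: Rx selberg_weight_def v_def prod.remove[OF fin j] powr_diff field_simps)
    also have "\<dots> \<le> C * (R x * \<bar>s - x j\<bar> powr (g - 1))"
    proof (intro mult_right_mono)
      have 1: "v s * (1 - s\<^sup>2) \<le> 2 powr (a + 1) * 2 powr (b + 1)"
      proof -
        have "v s * (1 - s\<^sup>2) = (1 - s) powr (a + 1) * (1 + s) powr (b + 1)"
          using s by (simp add: v_def beta_weight_def powr_add power2_eq_square algebra_simps)
        also have "\<dots> \<le> 2 powr (a + 1) * 2 powr (b + 1)"
          using s a b by (intro mult_mono powr_mono2) auto
        finally show ?thesis .
      qed
      have 2: "(\<Prod>k\<in>J - {j}. \<bar>s - x k\<bar> powr g) \<le> (2 powr g) ^ card (J - {j})"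
      proof (intro prod_le_power_card conjI powr_mono2)
        fix k assume "k \<in> J - {j}"
        then have "-1 < x k" "x k < 1" using x by (auto simp: open_chamber_def)
        with s show "\<bar>s - x k\<bar> \<le> 2" by (simp add: abs_le_iff)
      qed (use g in auto)
      have 3: "\<bar>F (x(i := s))\<bar> \<le> \<bar>B\<bar>" using F_le[OF True] by simp
      show "vandermonde_powr g J x * ((v s * (1 - s\<^sup>2)) * (\<Prod>k\<in>J - {j}. \<bar>s - x k\<bar> powr g) * \<bar>F (x(i := s))\<bar>) \<le> C"
        unfolding C_def
      proof (rule mult_mono[OF vandermonde_powr_le[OF g fin x] mult_mono[OF mult_mono[OF 1 2] 3]])
        have "0 \<le> 1 - s\<^sup>2" using s by (simp add: abs_square_le_1 abs_le_iff)
        with v0 have Y: "0 \<le> v s * (1 - s\<^sup>2)" by (intro mult_nonneg_nonneg)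
        show "0 \<le> v s * (1 - s\<^sup>2) * (\<Prod>k\<in>J - {j}. \<bar>s - x k\<bar> powr g) * \<bar>F (x(i := s))\<bar>"
          by (intro mult_nonneg_nonneg[OF mult_nonneg_nonneg[OF Y]] prod_nonneg) auto
      qed (auto intro: prod_nonneg)
    qed (use R0 in auto)
    finally show ?thesis using s by (simp add: mult.assoc)
  qed (use C0 R0 in \<open>simp add: indicator_def\<close>)
  have "(\<integral>\<^sup>+x. ennreal (norm (?f x)) \<partial>PiM (insert i J) (\<lambda>_. lborel))
     = (\<integral>\<^sup>+x. (\<integral>\<^sup>+s. ennreal (norm (?f (x(i := s)))) \<partial>lborel) \<partial>PiM J (\<lambda>_. lborel))"
    by (rule product_nn_integral_insert[OF fin i]) measurable
  also have "\<dots> \<le> (\<integral>\<^sup>+x. ennreal (C * K) * ennreal (R x) \<partial>PiM J (\<lambda>_. lborel))"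
  proof (rule nn_integral_mono)
    fix x :: "nat \<Rightarrow> real"
    have "(\<integral>\<^sup>+s. ennreal (norm (?f (x(i := s)))) \<partial>lborel)
      \<le> (\<integral>\<^sup>+s. ennreal (C * R x) * ennreal (indicator {-1..1} s * \<bar>s - x j\<bar> powr (g - 1)) \<partial>lborel)"
    proof (rule nn_integral_mono)
      fix s
      show "ennreal (norm (?f (x(i := s)))) \<le> ennreal (C * R x) * ennreal (indicator {-1..1} s * \<bar>s - x j\<bar> powr (g - 1))"
        using ennreal_leI[OF bound[of x s]] C0 R0[of x] by (simp add: ennreal_mult')
    qed
    also have "\<dots> = ennreal (C * R x) * (\<integral>\<^sup>+s. ennreal (indicator {-1..1} s * \<bar>s - x j\<bar> powr (g - 1)) \<partial>lborel)"
      by (rule nn_integral_cmult) simp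
    also have "\<dots> \<le> ennreal (C * R x) * ennreal K"
    proof (cases "x j \<in> {-1..1}")
      case True
      then show ?thesis by (intro mult_left_mono K) auto
    next
      \<comment> \<open>The uniform bound covers only \<open>x j\<close> in [-1, 1]; elsewhere the
        indicator inside \<open>R\<close> makes the whole term vanish.\<close>
      case False
      then have "R x = 0" unfolding R_def using fin j by (intro prod_zero bexI[of _ j]) auto
      then show ?thesis by simp
    qed
    also have "\<dots> = ennreal (C * K) * ennreal (R x)"
      using C0 K R0[of x] by (simp add: ennreal_mult'[symmetric] ac_simps)
    finally show "(\<integral>\<^sup>+s. ennreal (norm (?f (x(i := s)))) \<partial>lborel) \<le> ennreal (C * K) * ennreal (R x)" .
  qed
  also have "\<dots> = ennreal (C * K) * (\<integral>\<^sup>+x. ennreal (R x) \<partial>PiM J (\<lambda>_. lborel))"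
    unfolding R_def v_def
    by (rule nn_integral_cmult[OF measurable_compose[OF measurable_prod_beta_weight[OF fin] measurable_ennreal]])
  also have "(\<integral>\<^sup>+x. ennreal (R x) \<partial>PiM J (\<lambda>_. lborel))
     = (\<integral>\<^sup>+x. (\<Prod>k\<in>J. ennreal (indicator {-1<..<1} (x k) * v (x k))) \<partial>PiM J (\<lambda>_. lborel))"
    unfolding R_def by (intro nn_integral_cong prod_ennreal[symmetric] mult_nonneg_nonneg v0) auto
  also have "\<dots> = (\<Prod>k\<in>J. \<integral>\<^sup>+s. ennreal (indicator {-1<..<1} s * v s) \<partial>lborel)"
    by (rule product_nn_integral_prod) (auto simp: v_def beta_weight_def)
  also have "ennreal (C * K) * \<dots> < \<infinity>"
    using nn_integral_beta_weight_finite[OF a b]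
    by (simp add: v_def ennreal_mult_less_top power_less_top_ennreal)
  finally show "(\<integral>\<^sup>+x. ennreal (norm (?f x)) \<partial>PiM (insert i J) (\<lambda>_. lborel)) < \<infinity>" .
qed

text \<open>The first-order terms give the first derivative after replacing \<open>x i\<close> by
  \<open>y - (y - x i)\<close>. The interaction terms have antisymmetric denominators, so exchanging
  \<open>i\<close> and \<open>j\<close> cancels each denominator; since every unordered pair is then
  counted twice, the factor \<open>g / 2\<close> appears.\<close>

lemma sum_chamber_divergence:
  fixes x :: "nat \<Rightarrow> real"
  assumes fin: "finite I" and inj: "inj_on x I"
  defines "p \<equiv> \<Prod>i\<in>I. [:- x i, 1:]"
  shows "(\<Sum>i\<in>I. chamber_divergence a b g I y i x)
    = (g / 2) * (1 - y\<^sup>2) * poly (pderiv (pderiv p)) y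
      + (b - a - (a + b + 2) * y) * poly (pderiv p) y
      + (real (card I) * (a + b + 2) + (g / 2) * (real (card I) * (real (card I) - 1))) * poly p y"
proof -
  define F where "F = (\<lambda>A. \<Prod>k\<in>A. y - x k)"
  have Frem: "F A = (y - x i) * F (A - {i})" if "finite A" "i \<in> A" for A i
    using that by (simp add: F_def prod.remove)
  have p0: "poly p y = F I" by (simp add: p_def F_def poly_prod)
  have p1: "poly (pderiv p) y = (\<Sum>i\<in>I. F (I - {i}))"
    by (simp add: p_def F_def pderiv_prod poly_sum poly_prod pderiv_pCons)
  have p2: "poly (pderiv (pderiv p)) y = (\<Sum>i\<in>I. \<Sum>j\<in>I - {i}. F (I - {i} - {j}))"
    by (simp add: p_def F_def pderiv_prod poly_sum poly_prod pderiv_pCons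
      higher_pderiv_sum[of 1, simplified])
  define h where "h = (\<lambda>i j. F (I - {i}) * (g * (1 - (x i)\<^sup>2) / (x i - x j)))"
  have 1: "F (I - {i}) * ((b + 1) * (1 - x i) - (a + 1) * (1 + x i))
      = (b - a - (a + b + 2) * y) * F (I - {i}) + (a + b + 2) * F I" if "i \<in> I" for i
    unfolding Frem[OF fin that] by algebra
  \<comment> \<open>The cancellation rests on the identity (1 - u^2)(y - v) - (1 - v^2)(y - u) = (u
    - v)(1 - y^2 + (y - u)(y - v)) for u = \<open>x i\<close> and v = \<open>x j\<close>.\<close>
  have hh: "h i j + h j i = g * (1 - y\<^sup>2) * F (I - {i} - {j}) + g * F I"
    if ij: "i \<in> I" "j \<in> I - {i}" for i j
  proof -
    let ?G = "F (I - {i} - {j})"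
    have sw: "I - {j} - {i} = I - {i} - {j}" by auto
    have ne: "x i - x j \<noteq> 0" using inj ij by (auto dest: inj_onD)
    have A: "F (I - {i}) = (y - x j) * ?G" using Frem[of "I - {i}" j] fin ij by simp
    have B: "F (I - {j}) = (y - x i) * ?G" using Frem[of "I - {j}" i] fin ij sw by auto
    have C: "F I = (y - x i) * (y - x j) * ?G" using Frem[OF fin, of i] ij A by simp
    define d where "d = x i - x j"
    have "h i j = F (I - {i}) * (g * (1 - (x i)\<^sup>2)) / d" by (simp add: h_def d_def)
    moreover have "h j i = - (F (I - {j}) * (g * (1 - (x j)\<^sup>2)) / d)"
      using minus_divide_right[of "F (I - {j}) * (g * (1 - (x j)\<^sup>2))" d] by (simp add: h_def d_def)
    ultimately have "(h i j + h j i) * (x i - x j) = F (I - {i}) * (g * (1 - (x i)\<^sup>2)) - F (I - {j}) * (g * (1 - (x j)\<^sup>2))"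
      using ne by (simp add: d_def[symmetric] left_diff_distrib)
    also have "\<dots> = (g * (1 - y\<^sup>2) * ?G + g * F I) * (x i - x j)"
      unfolding A B C by algebra
    finally show ?thesis using ne by simp
  qed
  have swap: "(\<Sum>i\<in>I. \<Sum>j\<in>I - {i}. h i j) = (\<Sum>i\<in>I. \<Sum>j\<in>I - {i}. h j i)"
  proof -
    have e: "I - {i} = {j\<in>I. i \<noteq> j}" "I - {i} = {j\<in>I. j \<noteq> i}" for i by auto
    have "(\<Sum>i\<in>I. \<Sum>j\<in>I - {i}. h i j) = (\<Sum>j\<in>I. \<Sum>i\<in>{i\<in>I. i \<noteq> j}. h i j)"
      unfolding e(1) by (rule sum.swap_restrict[OF fin fin])
    then show ?thesis unfolding e(2) .
  qed
  have "2 * (\<Sum>i\<in>I. \<Sum>j\<in>I - {i}. h i j) = (\<Sum>i\<in>I. \<Sum>j\<in>I - {i}. h i j + h j i)"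
    using swap by (simp add: sum.distrib)
  also have "\<dots> = (\<Sum>i\<in>I. \<Sum>j\<in>I - {i}. g * (1 - y\<^sup>2) * F (I - {i} - {j}) + g * F I)"
    by (intro sum.cong refl hh)
  also have "\<dots> = g * (1 - y\<^sup>2) * poly (pderiv (pderiv p)) y
      + g * F I * (real (card I) * (real (card I) - 1))"
  proof -
    have "(\<Sum>i\<in>I. \<Sum>j\<in>I - {i}. g * F I) = g * F I * (real (card I) * (real (card I) - 1))"
    proof (cases "I = {}")
      case False
      then have "card I \<ge> 1" using fin by (simp add: Suc_leI card_gt_0_iff)
      then show ?thesis using fin by (simp add: card_Diff_singleton)
    qed simp
    then show ?thesis by (simp add: sum.distrib p2 sum_distrib_left)
  qed
  finally have S: "(\<Sum>i\<in>I. \<Sum>j\<in>I - {i}. h i j) = (g / 2) * (1 - y\<^sup>2) * poly (pderiv (pderiv p)) y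
      + (g / 2) * F I * (real (card I) * (real (card I) - 1))" by simp
  have "(\<Sum>i\<in>I. chamber_divergence a b g I y i x)
    = (\<Sum>i\<in>I. F (I - {i}) * ((b + 1) * (1 - x i) - (a + 1) * (1 + x i)) + (\<Sum>j\<in>I - {i}. h i j))"
    by (simp add: chamber_divergence_def F_def h_def distrib_left sum_distrib_left)
  also have "\<dots> = (\<Sum>i\<in>I. (b - a - (a + b + 2) * y) * F (I - {i}) + (a + b + 2) * F I)
      + (\<Sum>i\<in>I. \<Sum>j\<in>I - {i}. h i j)"
    by (simp add: sum.distrib 1 cong: sum.cong)
  also have "\<dots> = (b - a - (a + b + 2) * y) * poly (pderiv p) y + real (card I) * (a + b + 2) * F I
      + (\<Sum>i\<in>I. \<Sum>j\<in>I - {i}. h i j)"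
    by (simp add: sum.distrib p1 sum_distrib_left)
  finally show ?thesis unfolding S p0 by (simp add: algebra_simps)
qed

section \<open>Vanishing of the integrated divergence\<close>

lemma abs_prod_diff_le:
  assumes "x \<in> open_chamber I" and "A \<subseteq> I"
  shows "\<bar>\<Prod>j\<in>A. y - x j\<bar> \<le> (\<bar>y\<bar> + 1) ^ card A"
  unfolding abs_prod
proof (rule prod_le_power_card)
  fix j assume "j \<in> A"
  then have "-1 < x j" "x j < 1" using assms by (auto simp: open_chamber_def)
  then show "0 \<le> \<bar>y - x j\<bar> \<and> \<bar>y - x j\<bar> \<le> \<bar>y\<bar> + 1" by (auto simp: abs_le_iff)
qed

text \<open>The divergence splits into a part that is bounded on the chamber, hence dominated by a
  multiple of the weight, and finitely many terms with a single denominator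
  \<open>x i - x j\<close>, covered by \<open>integrable_singular_term\<close>.\<close>

lemma integrable_chamber_divergence:
  assumes fin [simp]: "finite J" and i: "i \<notin> J" and g: "g > 0" and a: "a > -1" and b: "b > -1"
    and int: "integrable (PiM (insert i J) (\<lambda>_. lborel))
      (\<lambda>x. indicator (open_chamber (insert i J)) x * selberg_weight a b g (insert i J) x)"
  shows "integrable (PiM (insert i J) (\<lambda>_. lborel)) (\<lambda>x. indicator (open_chamber (insert i J)) x *
    (selberg_weight a b g (insert i J) x * chamber_divergence a b g (insert i J) y i x))"
proof -
  let ?M = "PiM (insert i J) (\<lambda>_. lborel :: real measure)"
  let ?U = "open_chamber (insert i J)"
  let ?w = "selberg_weight a b g (insert i J)"
  have J: "insert i J - {i} = J" using i by auto
  have [measurable]: "(\<lambda>x. indicator ?U x :: real) \<in> borel_measurable ?M"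
    using measurable_open_chamber[of "insert i J"] by (intro borel_measurable_indicator') simp_all
  define F where "F = (\<lambda>x::nat \<Rightarrow> real. \<Prod>j\<in>J. y - x j)"
  define B where "B = (\<bar>y\<bar> + 1) ^ card J"
  have F_le: "\<bar>F x\<bar> \<le> B" if "x \<in> ?U" for x
    unfolding F_def B_def by (rule abs_prod_diff_le[OF that]) auto
  have F [measurable]: "F \<in> borel_measurable ?M" unfolding F_def by measurable
  define q where "q = (\<lambda>x::nat \<Rightarrow> real. (b + 1) * (1 - x i) - (a + 1) * (1 + x i))"
  have q_le: "\<bar>q x\<bar> \<le> 2 * (b + 1) + 2 * (a + 1)" if "x \<in> ?U" for x
  proof -
    have "-1 < x i" "x i < 1" using that by (auto simp: open_chamber_def)
    then have "0 \<le> (b + 1) * (1 - x i)" "(b + 1) * (1 - x i) \<le> (b + 1) * 2"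
      "0 \<le> (a + 1) * (1 + x i)" "(a + 1) * (1 + x i) \<le> (a + 1) * 2"
      using a b by (intro mult_nonneg_nonneg mult_left_mono; simp)+
    then show ?thesis by (simp add: q_def abs_le_iff)
  qed
  have 1: "integrable ?M (\<lambda>x. indicator ?U x * ?w x * (F x * q x))"
  proof (rule Bochner_Integration.integrable_bound)
    show "integrable ?M (\<lambda>x. (indicator ?U x * ?w x) * (B * (2 * (b + 1) + 2 * (a + 1))))"
      using int by (rule integrable_mult_left)
    show "(\<lambda>x. indicator ?U x * ?w x * (F x * q x)) \<in> borel_measurable ?M"
      unfolding q_def by measurable
    show "AE x in ?M. norm (indicator ?U x * ?w x * (F x * q x))
        \<le> norm ((indicator ?U x * ?w x) * (B * (2 * (b + 1) + 2 * (a + 1))))"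
    proof (rule AE_I2)
      fix x
      show "norm (indicator ?U x * ?w x * (F x * q x))
        \<le> norm ((indicator ?U x * ?w x) * (B * (2 * (b + 1) + 2 * (a + 1))))"
      proof (cases "x \<in> ?U")
        case True
        have "\<bar>F x * q x\<bar> \<le> B * (2 * (b + 1) + 2 * (a + 1))"
          unfolding abs_mult using F_le[OF True] q_le[OF True] by (intro mult_mono) (auto simp: B_def)
        then have "\<bar>?w x\<bar> * \<bar>F x * q x\<bar> \<le> \<bar>?w x\<bar> * \<bar>B * (2 * (b + 1) + 2 * (a + 1))\<bar>"
          by (intro mult_left_mono) auto
        then show ?thesis using True by (simp add: abs_mult)
      qed simp
    qed
  qed
  have 2: "integrable ?M (\<lambda>x. indicator ?U x * (?w x * (F x * ((1 - (x i)\<^sup>2) / (x i - x j)))))"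
    if "j \<in> J" for j
    by (rule integrable_singular_term[OF fin i that g a b F F_le])
  have "integrable ?M (\<lambda>x. indicator ?U x * ?w x * (F x * q x) +
     (\<Sum>j\<in>J. g * (indicator ?U x * (?w x * (F x * ((1 - (x i)\<^sup>2) / (x i - x j)))))))"
    by (intro Bochner_Integration.integrable_add 1 Bochner_Integration.integrable_sum integrable_mult_right 2)
  then show ?thesis
    by (rule Bochner_Integration.integrable_cong[THEN iffD1, OF refl, rotated])
      (simp add: chamber_divergence_def J F_def q_def distrib_left sum_distrib_left ac_simps)
qed

text \<open>Fubini with coordinate \<open>i\<close> as the inner variable reduces the integral to
  the slices, each of which is 0. Joint integrability is what permits the iteration.\<close>

lemma integral_chamber_divergence:
  assumes "finite I" and "i \<in> I" and "g > 0" and "a > -1" and "b > -1"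
    and int: "integrable (PiM I (\<lambda>_. lborel))
      (\<lambda>x. indicator (open_chamber I) x * selberg_weight a b g I x)"
  shows "has_bochner_integral (PiM I (\<lambda>_. lborel)) (\<lambda>x. indicator (open_chamber I) x *
    (selberg_weight a b g I x * chamber_divergence a b g I y i x)) 0"
proof -
  interpret product_sigma_finite "\<lambda>_::nat. lborel :: real measure"
    by standard
  define J where "J = I - {i}"
  have J: "finite J" "i \<notin> J" "I = insert i J" using assms by (auto simp: J_def)
  have *: "integrable (PiM (insert i J) (\<lambda>_. lborel)) (\<lambda>x. indicator (open_chamber (insert i J)) x *
    (selberg_weight a b g (insert i J) x * chamber_divergence a b g (insert i J) y i x))"
    using assms J by (intro integrable_chamber_divergence) auto
  show ?thesis
    unfolding has_bochner_integral_iff J(3)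
    using * product_integral_insert[OF J(1,2) *] integral_chamber_divergence_slice[OF J(1,2) assms(3-5)]
    by (simp del: fun_upd_apply)
qed

lemma open_chamber_inj_on: "x \<in> open_chamber I \<Longrightarrow> inj_on x I"
  by (rule inj_onI) (metis (mono_tags, lifting) less_irrefl linorder_neqE_nat mem_Collect_eq open_chamber_def)

lemma integral_selberg_weight_jacobi_operator:
  fixes y :: real
  assumes "finite I" and "g > 0" and "a > -1" and "b > -1"
    and int: "integrable (PiM I (\<lambda>_. lborel))
      (\<lambda>x. indicator (open_chamber I) x * selberg_weight a b g I x)"
  defines "p \<equiv> \<lambda>x. \<Prod>i\<in>I. [:- x i, 1:]"
  shows "(LINT x|PiM I (\<lambda>_. lborel). indicator (open_chamber I) x * (selberg_weight a b g I x *
      ((g / 2) * (1 - y\<^sup>2) * poly (pderiv (pderiv (p x))) y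
      + (b - a - (a + b + 2) * y) * poly (pderiv (p x)) y
      + (real (card I) * (a + b + 2) + (g / 2) * (real (card I) * (real (card I) - 1))) * poly (p x) y))) = 0"
    (is "integral\<^sup>L _ ?f = 0")
proof -
  have eq: "?f = (\<lambda>x. \<Sum>i\<in>I. indicator (open_chamber I) x *
    (selberg_weight a b g I x * chamber_divergence a b g I y i x))"
  proof
    fix x
    show "?f x = (\<Sum>i\<in>I. indicator (open_chamber I) x *
    (selberg_weight a b g I x * chamber_divergence a b g I y i x))"
    proof (cases "x \<in> open_chamber I")
      case True
      then show ?thesis
        using sum_chamber_divergence[OF assms(1) open_chamber_inj_on[OF True], of a b g y]
        by (simp add: p_def sum_distrib_left[symmetric])
    qed simp
  qed
  have "has_bochner_integral (PiM I (\<lambda>_. lborel)) ?f (\<Sum>i\<in>I. 0)"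
    unfolding eq by (intro has_bochner_integral_sum integral_chamber_divergence) (use assms(1-5) in auto)
  then show ?thesis by (simp add: has_bochner_integral_iff)
qed

section \<open>Jacobi polynomials\<close>

text \<open>Coefficients with respect to the powers of \<open>y - 1\<close>.\<close>

definition jacobi_coeff :: "nat \<Rightarrow> real \<Rightarrow> real \<Rightarrow> nat \<Rightarrow> real" where
  "jacobi_coeff n \<alpha> \<beta> k = real (n choose k)
     * (pochhammer (real n + \<alpha> + \<beta> + 1) k * pochhammer (\<alpha> + real k + 1) (n - k) / fact n) / 2 ^ k"

text \<open>This is the recurrence of the Jacobi equation expanded at 1. The binomial coefficient
  yields \<open>n - k\<close> and \<open>k + 1\<close>, the first Pochhammer symbol gains one
  factor, the second loses \<open>\<alpha> + k + 1\<close>, and the power of two yields 2.\<close>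

lemma jacobi_coeff_Suc:
  assumes "k < n"
  shows "(real n - real k) * (real n + real k + \<alpha> + \<beta> + 1) * jacobi_coeff n \<alpha> \<beta> k
    = 2 * (real k + 1) * (real k + \<alpha> + 1) * jacobi_coeff n \<alpha> \<beta> (Suc k)"
proof -
  have 1: "real (Suc k) * real (n choose Suc k) = (real n - real k) * real (n choose k)"
  proof -
    have "Suc k * (n choose Suc k) = (n - k) * (n choose k)"
      by (simp only: binomial_absorption binomial_absorb_comp)
    then show ?thesis using assms by (metis of_nat_diff of_nat_mult less_imp_le)
  qed
  obtain m where m: "n = Suc (k + m)" using assms less_iff_Suc_add by blast
  have 2: "pochhammer (\<alpha> + real k + 1) (n - k) = (\<alpha> + real k + 1) * pochhammer (\<alpha> + real (Suc k) + 1) (n - Suc k)"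
    unfolding m by (simp add: pochhammer_rec algebra_simps)
  have 3: "pochhammer (real n + \<alpha> + \<beta> + 1) (Suc k) =
      pochhammer (real n + \<alpha> + \<beta> + 1) k * (real n + real k + \<alpha> + \<beta> + 1)"
    by (simp add: pochhammer_Suc algebra_simps)
  define P Q R S where "P = pochhammer (real n + \<alpha> + \<beta> + 1) k"
    and "Q = pochhammer (\<alpha> + real (Suc k) + 1) (n - Suc k)"
    and "R = real n + real k + \<alpha> + \<beta> + 1" and "S = \<alpha> + real k + 1"
  have J: "jacobi_coeff n \<alpha> \<beta> k = real (n choose k) * (P * (S * Q) / fact n) / 2 ^ k"
    unfolding jacobi_coeff_def 2 P_def Q_def S_def ..
  have "2 * (real k + 1) * (real k + \<alpha> + 1) * jacobi_coeff n \<alpha> \<beta> (Suc k)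
    = (real (Suc k) * real (n choose Suc k)) * (P * R * Q * S / fact n / 2 ^ k)"
    unfolding jacobi_coeff_def 3 P_def[symmetric] Q_def[symmetric] R_def[symmetric]
    by (simp add: S_def field_simps)
  also have "\<dots> = (real n - real k) * R * jacobi_coeff n \<alpha> \<beta> k"
    unfolding 1 J by (simp add: algebra_simps)
  finally show ?thesis by (simp add: R_def)
qed

lemma jacobi_coeff_top:
  "jacobi_coeff n \<alpha> \<beta> n = ((2 * real n + \<alpha> + \<beta>) gchoose n) / 2 ^ n"
proof -
  have "2 * real n + \<alpha> + \<beta> - real n + 1 = real n + \<alpha> + \<beta> + 1" by simp
  then show ?thesis by (simp add: jacobi_coeff_def gbinomial_pochhammer' add.assoc)
qed

text \<open>Since \<open>\<alpha> + \<beta> > -2\<close>, the base of the Pochhammer symbol exceeds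
  \<open>n - 1\<close>, which is nonnegative.\<close>

lemma jacobi_coeff_top_pos:
  assumes "n \<ge> 1" and "\<alpha> > -1" and "\<beta> > -1"
  shows "jacobi_coeff n \<alpha> \<beta> n > 0"
  using assms by (auto simp: jacobi_coeff_def intro!: divide_pos_pos pochhammer_pos)

lemma coeff_jacobi_poly:
  "coeff (jacobi_poly n \<alpha> \<beta>) m = (\<Sum>l=m..n. (-1) ^ (l - m) * real (l choose m) * jacobi_coeff n \<alpha> \<beta> l)"
proof -
  have c: "coeff ([:- 1 / 2, 1 / 2:] ^ l) m = (if m \<le> l then (-1) ^ (l - m) * real (l choose m) / 2 ^ l else (0 :: real))" for l
  proof (cases "m \<le> l")
    case True
    have "(- (1 / 2 :: real)) ^ (l - m) * (1 / 2) ^ m = (-1) ^ (l - m) / 2 ^ l"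
    proof -
      have "(- (1 / 2 :: real)) ^ (l - m) = (-1) ^ (l - m) * (1 / 2) ^ (l - m)"
        by (metis mult_minus1 power_mult_distrib)
      moreover have "(1 / 2 :: real) ^ (l - m) * (1 / 2) ^ m = 1 / 2 ^ l"
        using True by (simp add: power_add[symmetric] power_one_over)
      ultimately show ?thesis by (simp add: mult.assoc)
    qed
    then show ?thesis using True by (simp add: coeff_linear_poly_power mult.commute mult.left_commute)
  qed (simp add: coeff_eq_0 degree_power_eq)
  have "coeff (jacobi_poly n \<alpha> \<beta>) m = (\<Sum>l\<in>{0..n}. if m \<le> l then (-1) ^ (l - m) * real (l choose m) * jacobi_coeff n \<alpha> \<beta> l else 0)"
    unfolding jacobi_poly_def coeff_sum coeff_smult c
    by (intro sum.cong refl) (simp add: jacobi_coeff_def ac_simps)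
  also have "\<dots> = (\<Sum>l=m..n. (-1) ^ (l - m) * real (l choose m) * jacobi_coeff n \<alpha> \<beta> l)"
    by (subst sum.inter_filter[symmetric]) (auto intro!: sum.cong)
  finally show ?thesis .
qed

lemma lead_coeff_jacobi_poly:
  assumes "n \<ge> 1" and "\<alpha> > -1" and "\<beta> > -1"
  shows "lead_coeff (jacobi_poly n \<alpha> \<beta>) = jacobi_coeff n \<alpha> \<beta> n"
proof -
  have 1: "coeff (jacobi_poly n \<alpha> \<beta>) n = jacobi_coeff n \<alpha> \<beta> n"
    by (simp add: coeff_jacobi_poly)
  have "degree (jacobi_poly n \<alpha> \<beta>) \<le> n"
    by (rule degree_le) (simp add: coeff_jacobi_poly)
  moreover have "n \<le> degree (jacobi_poly n \<alpha> \<beta>)"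
    by (rule le_degree) (use 1 jacobi_coeff_top_pos[OF assms] in simp)
  ultimately show ?thesis using 1 by simp
qed

lemma poly_jacobi_poly_shift:
  "poly (jacobi_poly n \<alpha> \<beta>) y = (\<Sum>k\<le>n. jacobi_coeff n \<alpha> \<beta> k * (y - 1) ^ k)"
  by (simp add: poly_jacobi_poly jacobi_coeff_def atLeast0AtMost power_divide)

text \<open>Descending induction from the normalized top coefficient. The recurrence can be solved
  for \<open>c k\<close> because \<open>n + k + \<alpha> + \<beta> + 1 > n + k - 1\<close> and the
  right side is nonnegative.\<close>

lemma jacobi_ode_coeff_unique:
  fixes c :: "nat \<Rightarrow> real"
  assumes ab: "\<alpha> > -1" "\<beta> > -1" and "n \<ge> 1" and cn: "c n = 1"
    and rec: "\<And>k. k < n \<Longrightarrow> (real n - real k) * (real n + real k + \<alpha> + \<beta> + 1) * c k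
      = 2 * (real k + 1) * (real k + \<alpha> + 1) * c (Suc k)"
    and "k \<le> n"
  shows "c k = jacobi_coeff n \<alpha> \<beta> k / jacobi_coeff n \<alpha> \<beta> n"
  using \<open>k \<le> n\<close>
proof (induction rule: inc_induct)
  case base
  then show ?case using cn jacobi_coeff_top_pos[of n \<alpha> \<beta>] assms by simp
next
  case (step k)
  let ?R = "(real n - real k) * (real n + real k + \<alpha> + \<beta> + 1)"
  have ne: "?R \<noteq> 0" using step ab \<open>n \<ge> 1\<close> by auto
  have "?R * c k = ?R * (jacobi_coeff n \<alpha> \<beta> k / jacobi_coeff n \<alpha> \<beta> n)"
    using rec[OF \<open>k < n\<close>] jacobi_coeff_Suc[OF \<open>k < n\<close>, of \<alpha> \<beta>] step.IH
    by (metis times_divide_eq_right)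
  then show ?case by (simp only: mult_left_cancel[OF ne])
qed

text \<open>The Jacobi operator at \<open>y = z + 1\<close>, where it maps \<open>z ^ k\<close> into the span of \<open>z ^ k\<close> and
  \<open>z ^ (k - 1)\<close> only.\<close>

lemma jacobi_ode_recurrence:
  fixes q :: "real poly" and \<alpha> \<beta> :: real
  assumes ode: "\<And>z. - z * (z + 2) * poly (pderiv (pderiv q)) z
      - (2 * (\<alpha> + 1) + (\<alpha> + \<beta> + 2) * z) * poly (pderiv q) z
      + real n * (real n + \<alpha> + \<beta> + 1) * poly q z = 0"
  shows "(real n - real k) * (real n + real k + \<alpha> + \<beta> + 1) * coeff q k
      = 2 * (real k + 1) * (real k + \<alpha> + 1) * coeff q (Suc k)"
proof -
  define p where "p = [:0, -2, -1:] * pderiv (pderiv q)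
     + [:- 2 * (\<alpha> + 1), - (\<alpha> + \<beta> + 2):] * pderiv q
     + smult (real n * (real n + \<alpha> + \<beta> + 1)) q"
  have "poly p z = 0" for z
    using ode[of z] by (simp add: p_def algebra_simps)
  then have "p = 0" using poly_all_0_iff_0 by blast
  then have "coeff p k = 0" by simp
  \<comment> \<open>The coefficient of \<open>z ^ k\<close> has the eigenvalue difference n(n + s) -
    k(k + s) = (n - k)(n + k + s) with s = \<open>\<alpha> + \<beta> + 1\<close>. The case
    distinctions resolve the index shifts caused by multiplication with \<open>z\<close> and
    \<open>z ^ 2\<close>.\<close>
  moreover have "coeff p k = (real n - real k) * (real n + real k + \<alpha> + \<beta> + 1) * coeff q k
     - 2 * (real k + 1) * (real k + \<alpha> + 1) * coeff q (Suc k)"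
    by (cases k; cases "k - 1")
       (simp_all add: p_def coeff_pderiv coeff_pCons algebra_simps split: nat.split)
  ultimately show ?thesis by simp
qed

section \<open>Random polynomials and the ordered cube\<close>

lemma coeff_prod_linear_insert:
  assumes "finite J" and "m \<notin> J"
  shows "coeff (\<Prod>j\<in>insert m J. [:c j, 1:]) k = c m * coeff (\<Prod>j\<in>J. [:c j, 1:]) k
    + (if k = 0 then 0 else coeff (\<Prod>j\<in>J. [:c j, 1:]) (k - 1))"
  using assms by (cases k) simp_all

lemma measurable_coeff_prod_linear:
  fixes f :: "'i \<Rightarrow> 'a \<Rightarrow> real"
  assumes "finite J" and "\<And>j. j \<in> J \<Longrightarrow> f j \<in> borel_measurable M"
  shows "(\<lambda>\<omega>. coeff (\<Prod>j\<in>J. [:f j \<omega>, 1:]) k) \<in> borel_measurable M"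
  using assms
proof (induction J arbitrary: k)
  case (insert m J)
  have IH [measurable]: "(\<lambda>\<omega>. coeff (\<Prod>j\<in>J. [:f j \<omega>, 1:]) k) \<in> borel_measurable M" for k
    using insert by auto
  have [measurable]: "f m \<in> borel_measurable M" using insert by auto
  show ?case unfolding coeff_prod_linear_insert[OF insert.hyps] by measurable
qed simp

text \<open>Supplies integrability of the random coefficients, since all roots lie in
  [-1, 1].\<close>

lemma bounded_coeff_prod_linear:
  fixes B :: real
  assumes "finite J" and "B \<ge> 0"
  shows "\<exists>C. \<forall>c. (\<forall>j\<in>J. \<bar>c j\<bar> \<le> B) \<longrightarrow> \<bar>coeff (\<Prod>j\<in>J. [:c j, 1:]) k\<bar> \<le> C"
  using assms(1)
proof (induction J arbitrary: k)
  case (insert m J)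
  obtain C where C: "\<bar>coeff (\<Prod>j\<in>J. [:c j, 1:]) k\<bar> \<le> C" if "\<forall>j\<in>J. \<bar>c j\<bar> \<le> B" for c
    using insert.IH[of k] by auto
  obtain D where D: "\<bar>coeff (\<Prod>j\<in>J. [:c j, 1:]) (k - 1)\<bar> \<le> D" if "\<forall>j\<in>J. \<bar>c j\<bar> \<le> B" for c
    using insert.IH[of "k - 1"] by auto
  have "\<bar>coeff (\<Prod>j\<in>insert m J. [:c j, 1:]) k\<bar> \<le> B * C + D" if c: "\<forall>j\<in>insert m J. \<bar>c j\<bar> \<le> B" for c
  proof -
    let ?p = "\<Prod>j\<in>J. [:c j, 1:]"
    have "\<bar>c m * coeff ?p k\<bar> \<le> B * C"
      unfolding abs_mult using c C[of c] \<open>B \<ge> 0\<close> by (intro mult_mono) auto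
    moreover have "\<bar>if k = 0 then 0 else coeff ?p (k - 1)\<bar> \<le> D"
      using D[of c] c by (auto intro: order_trans[OF abs_ge_zero])
    ultimately show ?thesis unfolding coeff_prod_linear_insert[OF insert.hyps] by linarith
  qed
  then show ?case by blast
qed auto

lemma measurable_poly_coeff:
  fixes P :: "'a \<Rightarrow> real poly"
  assumes [measurable]: "\<And>k. (\<lambda>\<omega>. coeff (P \<omega>) k) \<in> borel_measurable M"
    and deg: "\<And>\<omega>. degree (P \<omega>) \<le> n"
  shows "(\<lambda>\<omega>. poly (P \<omega>) z) \<in> borel_measurable M"
    and "(\<lambda>\<omega>. poly (pderiv (P \<omega>)) z) \<in> borel_measurable M"
    and "(\<lambda>\<omega>. poly (pderiv (pderiv (P \<omega>))) z) \<in> borel_measurable M"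
proof -
  have P: "P \<omega> = (\<Sum>k\<le>n. monom (coeff (P \<omega>) k) k)" for \<omega>
    by (rule poly_as_sum_of_monoms'[OF deg, symmetric])
  show "(\<lambda>\<omega>. poly (P \<omega>) z) \<in> borel_measurable M"
    by (subst P, unfold poly_sum poly_monom) measurable
  show "(\<lambda>\<omega>. poly (pderiv (P \<omega>)) z) \<in> borel_measurable M"
    by (subst P, unfold higher_pderiv_sum[of 1, simplified] pderiv_monom poly_sum poly_monom) measurable
  show "(\<lambda>\<omega>. poly (pderiv (pderiv (P \<omega>))) z) \<in> borel_measurable M"
    by (subst P, unfold higher_pderiv_sum[of 1, simplified] pderiv_monom poly_sum poly_monom) measurable
qed

section \<open>The closed ordered cube and the open chamber\<close>

lemma ordered_cube_mono:
  assumes "x \<in> ordered_cube N" and "1 \<le> i" and "i \<le> j" and "j \<le> N"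
  shows "x i \<le> x j"
  using \<open>i \<le> j\<close> \<open>j \<le> N\<close>
proof (induction j rule: dec_induct)
  case (step j)
  then have "x j \<le> x (j + 1)" using assms(1,2) by (auto simp: ordered_cube_def)
  with step show ?case by simp
qed simp

lemma ordered_cube_bounds:
  assumes "x \<in> ordered_cube N" and "i \<in> {1..N}"
  shows "-1 \<le> x i" and "x i \<le> 1"
proof -
  have "x 1 \<le> x i" "x i \<le> x N" using assms by (auto intro: ordered_cube_mono)
  then show "-1 \<le> x i" "x i \<le> 1" using assms(1) by (auto simp: ordered_cube_def)
qed

text \<open>Equality holds pointwise and not just almost everywhere: on the boundary some coordinate
  is 1 or -1, or two coordinates agree, and \<open>0 powr e = 0\<close> for every \<open>e\<close>
  makes the weight vanish there.\<close>

lemma jacobi_weight_ordered_cube: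
  assumes N: "N \<ge> 1" and x: "x \<in> extensional {1..N}"
  shows "jacobi_weight N k1 k2 k3 x * indicator (ordered_cube N) x
    = indicator (open_chamber {1..N}) x
      * selberg_weight (k1 + k2 - 1 / 2) (k2 - 1 / 2) (2 * k3) {1..N} x"
proof -
  have w: "jacobi_weight N k1 k2 k3 x
      = selberg_weight (k1 + k2 - 1 / 2) (k2 - 1 / 2) (2 * k3) {1..N} x"
    unfolding jacobi_weight_def selberg_weight_def beta_weight_def vandermonde_powr_def
    by (intro arg_cong2[of _ _ _ _ "(*)"] prod.cong refl) auto
  have "x \<in> ordered_cube N" if "x \<in> open_chamber {1..N}"
    using that x N by (auto simp: ordered_cube_def open_chamber_def intro!: less_imp_le)
  moreover have "selberg_weight (k1 + k2 - 1 / 2) (k2 - 1 / 2) (2 * k3) {1..N} x = 0"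
    if c: "x \<in> ordered_cube N" and nc: "x \<notin> open_chamber {1..N}"
  proof -
    from nc consider i where "i \<in> {1..N}" "\<not> (-1 < x i \<and> x i < 1)"
      | i j where "i \<in> {1..N}" "j \<in> {1..N}" "i < j" "\<not> x i < x j"
      unfolding open_chamber_def by blast
    then show ?thesis
    proof cases
      case 1
      then have "x i = -1 \<or> x i = 1" using ordered_cube_bounds[OF c, of i] by auto
      then have "beta_weight (k1 + k2 - 1 / 2) (k2 - 1 / 2) (x i) = 0"
        by (auto simp: beta_weight_def)
      then show ?thesis using 1 unfolding selberg_weight_def by (auto intro!: prod_zero)
    next
      case 2
      then have "x i = x j" using ordered_cube_mono[OF c, of i j] by auto
      then have eq: "(\<Prod>j\<in>{j\<in>{1..N}. i < j}. \<bar>x i - x j\<bar> powr (2 * k3)) = 0"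
        using 2 by (intro prod_zero bexI[of _ j]) auto
      have "vandermonde_powr (2 * k3) {1..N} x = 0"
        unfolding vandermonde_powr_def by (intro prod_zero bexI[where x = i] eq) (use 2 in auto)
      then show ?thesis by (simp add: selberg_weight_def)
    qed
  qed
  ultimately show ?thesis unfolding w by (auto simp: indicator_def)
qed

text \<open>The uniform degree bound turns evaluation and differentiation into finite linear
  combinations of coefficients, so both commute with the expectation. The polynomial
  \<open>q\<close> is the coefficientwise expectation.\<close>

lemma expectation_poly:
  fixes P :: "'a \<Rightarrow> real poly"
  assumes int: "\<And>k. integrable M (\<lambda>\<omega>. coeff (P \<omega>) k)"
    and deg: "\<And>\<omega>. degree (P \<omega>) \<le> n"
  defines "q \<equiv> \<Sum>k\<le>n. monom (LINT \<omega>|M. coeff (P \<omega>) k) k"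
  shows "has_bochner_integral M (\<lambda>\<omega>. poly (P \<omega>) z) (poly q z)"
    and "has_bochner_integral M (\<lambda>\<omega>. poly (pderiv (P \<omega>)) z) (poly (pderiv q) z)"
    and "has_bochner_integral M (\<lambda>\<omega>. poly (pderiv (pderiv (P \<omega>))) z) (poly (pderiv (pderiv q)) z)"
    and "coeff q k = (LINT \<omega>|M. coeff (P \<omega>) k)"
proof -
  have P: "P \<omega> = (\<Sum>k\<le>n. monom (coeff (P \<omega>) k) k)" for \<omega>
    by (rule poly_as_sum_of_monoms'[OF deg, symmetric])
  have int': "has_bochner_integral M (\<lambda>\<omega>. coeff (P \<omega>) k) (LINT \<omega>|M. coeff (P \<omega>) k)" for k
    by (rule has_bochner_integral_integrable[OF int])
  show "has_bochner_integral M (\<lambda>\<omega>. poly (P \<omega>) z) (poly q z)"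
    unfolding q_def by (subst P, unfold poly_sum poly_monom)
      (intro has_bochner_integral_sum has_bochner_integral_mult_left int')
  show "has_bochner_integral M (\<lambda>\<omega>. poly (pderiv (P \<omega>)) z) (poly (pderiv q) z)"
    unfolding q_def
    by (subst P, unfold higher_pderiv_sum[of 1, simplified] pderiv_monom poly_sum poly_monom)
      (intro has_bochner_integral_sum has_bochner_integral_mult_left has_bochner_integral_mult_right int')
  show "has_bochner_integral M (\<lambda>\<omega>. poly (pderiv (pderiv (P \<omega>))) z) (poly (pderiv (pderiv q)) z)"
    unfolding q_def
    by (subst P, unfold higher_pderiv_sum[of 1, simplified] pderiv_monom poly_sum poly_monom)
      (intro has_bochner_integral_sum has_bochner_integral_mult_left has_bochner_integral_mult_right int')
  have "coeff q k = (if k \<le> n then (LINT \<omega>|M. coeff (P \<omega>) k) else 0)"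
    by (simp add: q_def coeff_sum)
  moreover have "coeff (P \<omega>) k = 0" if "\<not> k \<le> n" for \<omega>
    using that deg[of \<omega>] by (simp add: coeff_eq_0)
  ultimately show "coeff q k = (LINT \<omega>|M. coeff (P \<omega>) k)" by simp
qed

lemma lead_coeff_prod_linear:
  fixes c :: "'i \<Rightarrow> real"
  assumes "finite I"
  shows "degree (\<Prod>i\<in>I. [:c i, 1:]) = card I" and "coeff (\<Prod>i\<in>I. [:c i, 1:]) (card I) = 1"
proof -
  show d: "degree (\<Prod>i\<in>I. [:c i, 1:]) = card I"
    by (subst degree_prod_eq_sum_degree) auto
  have "lead_coeff (\<Prod>i\<in>I. [:c i, 1:]) = 1"
    by (simp add: lead_coeff_prod)
  then show "coeff (\<Prod>i\<in>I. [:c i, 1:]) (card I) = 1" using d by simp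
qed

theorem corollary4p7:
  fixes N :: nat and k1 k2 k3 c \<alpha> \<beta> :: real
    and M :: "'a measure" and X :: "'a \<Rightarrow> nat \<Rightarrow> real"
  assumes "N \<ge> 1"
    and "k3 > 0" and "k2 > - 1 / 2" and "k1 + k2 > - 1 / 2"
    and "prob_space M"
    and "\<forall>\<omega>\<in>space M. X \<omega> \<in> ordered_cube N"
    and "c > 0"
    and "distributed M (PiM {1..N} (\<lambda>_. lborel)) X
           (\<lambda>x. ennreal (c * jacobi_weight N k1 k2 k3 x * indicator (ordered_cube N) x))"
    and "\<alpha> = (1 + 2 * k1 + 2 * k2) / (2 * k3) - 1"
    and "\<beta> = (1 + 2 * k2) / (2 * k3) - 1"
  shows "\<alpha> > -1 \<and> \<beta> > -1
    \<and> (\<forall>y::real. prob_space.expectation M (\<lambda>\<omega>. \<Prod>i=1..N. (y - X \<omega> i))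
          = 1 / lead_coeff (jacobi_poly N \<alpha> \<beta>) * poly (jacobi_poly N \<alpha> \<beta>) y)
    \<and> (\<forall>n\<in>{0..N}. prob_space.expectation M (\<lambda>\<omega>. elem_sym N n (X \<omega>))
          = 2 ^ N / ((2 * real N + \<alpha> + \<beta>) gchoose N)
            * (\<Sum>l=N-n..N. (-1) ^ (N - l) * real (N choose l) * real (l choose (N - n))
                 * (pochhammer (real N + \<alpha> + \<beta> + 1) l * pochhammer (\<alpha> + real l + 1) (N - l)
                    / (fact N * 2 ^ l))))"
proof -
  interpret prob_space M by fact

  \<comment> \<open>Parameters and integrability of the weight\<close>
  define a b g where "a = k1 + k2 - 1 / 2" and "b = k2 - 1 / 2" and "g = 2 * k3"
  let ?I = "{1..N}"
  let ?L = "PiM ?I (\<lambda>_. lborel :: real measure)"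
  let ?U = "open_chamber ?I"
  let ?w = "selberg_weight a b g ?I"
  define f where "f = (\<lambda>x. c * jacobi_weight N k1 k2 k3 x * indicator (ordered_cube N) x)"
  have g: "g > 0" and a: "a > -1" and b: "b > -1"
    using assms(2-4) by (simp_all add: a_def b_def g_def)
  \<comment> \<open>This explains the form of \<open>\<alpha>\<close> and \<open>\<beta>\<close>:
    they are the exponents that remain after dividing the differential equation by
    \<open>k3 = g / 2\<close>.\<close>
  have a1: "a + 1 = k3 * (\<alpha> + 1)" and b1: "b + 1 = k3 * (\<beta> + 1)"
    using assms(2,9,10) by (simp_all add: a_def b_def field_simps)
  have \<alpha>: "\<alpha> > -1" and \<beta>: "\<beta> > -1"
    using a b \<open>k3 > 0\<close> a1 b1 zero_less_mult_iff[of k3 "\<alpha> + 1"] zero_less_mult_iff[of k3 "\<beta> + 1"]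
    by auto
  have dist: "distributed M ?L X (\<lambda>x. ennreal (f x))"
    using assms(8) by (simp add: f_def)
  have f_nonneg: "f x \<ge> 0" for x
    using \<open>c > 0\<close> unfolding f_def jacobi_weight_def
    by (intro mult_nonneg_nonneg prod_nonneg ballI) auto
  have f: "f x = c * (indicator ?U x * ?w x)" if "x \<in> space ?L" for x
  proof -
    have "x \<in> extensional ?I" using that by (auto simp: space_PiM PiE_def)
    then show ?thesis
      using jacobi_weight_ordered_cube[OF assms(1), of x k1 k2 k3]
      by (simp add: f_def a_def b_def g_def mult.assoc)
  qed
  \<comment> \<open>The constant 1 is integrable on the probability space; transported to the
    density, this gives integrability of the weight.\<close>
  have "integrable ?L (\<lambda>x. f x * 1)"
    using distributed_integrable[OF dist, of "\<lambda>_. 1"] f_nonneg by simp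
  then have "integrable ?L (\<lambda>x. c * (indicator ?U x * ?w x))"
    using f by (subst Bochner_Integration.integrable_cong[OF refl, of _ _ f]) auto
  then have int: "integrable ?L (\<lambda>x. indicator ?U x * ?w x)"
    using \<open>c > 0\<close> by simp

  \<comment> \<open>The expected polynomial and its differential equation\<close>
  define p where "p = (\<lambda>x :: nat \<Rightarrow> real. \<Prod>i\<in>?I. [:- x i, 1:])"
  have X_meas: "(\<lambda>\<omega>. X \<omega> i) \<in> borel_measurable M" if "i \<in> ?I" for i
    using measurable_compose[OF distributed_measurable[OF dist] measurable_component_singleton[OF that]]
    by simp
  have bounds: "\<bar>- X \<omega> i\<bar> \<le> 1" if "i \<in> ?I" "\<omega> \<in> space M" for i \<omega>
    using ordered_cube_bounds[of "X \<omega>" N i] that assms(6) by (auto simp: abs_le_iff)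
  have coeff_int: "integrable M (\<lambda>\<omega>. coeff (p (X \<omega>)) k)" for k
  proof -
    have "\<exists>C. \<forall>c. (\<forall>j\<in>?I. \<bar>c j :: real\<bar> \<le> 1) \<longrightarrow> \<bar>coeff (\<Prod>j\<in>?I. [:c j, 1:]) k\<bar> \<le> C"
      by (rule bounded_coeff_prod_linear) auto
    then obtain C where C: "\<And>c. (\<forall>j\<in>?I. \<bar>c j\<bar> \<le> 1) \<Longrightarrow> \<bar>coeff (\<Prod>j\<in>?I. [:c j, 1:]) k\<bar> \<le> (C :: real)"
      by blast
    show ?thesis
    proof (rule integrable_const_bound)
      show "AE \<omega> in M. norm (coeff (p (X \<omega>)) k) \<le> C"
        using C[of "\<lambda>i. - X _ i"] bounds by (intro AE_I2) (simp add: p_def)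
      show "(\<lambda>\<omega>. coeff (p (X \<omega>)) k) \<in> borel_measurable M"
        unfolding p_def by (rule measurable_coeff_prod_linear) (use X_meas in auto)
    qed
  qed
  have deg: "degree (p x) = N" "coeff (p x) N = 1" for x
    using lead_coeff_prod_linear[of ?I "\<lambda>i. - x i"] by (simp_all add: p_def)

  define q where "q = (\<Sum>k\<le>N. monom (expectation (\<lambda>\<omega>. coeff (p (X \<omega>)) k)) k)"
  note q = expectation_poly[OF coeff_int eq_refl[OF deg(1)], folded q_def]
  have ode: "k3 * (1 - y\<^sup>2) * poly (pderiv (pderiv q)) y + (b - a - (a + b + 2) * y) * poly (pderiv q) y
      + (real N * (a + b + 2) + k3 * (real N * (real N - 1))) * poly q y = 0" for y
  proof -
    define T where "T = (\<lambda>x. (g / 2) * (1 - y\<^sup>2) * poly (pderiv (pderiv (p x))) y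
      + (b - a - (a + b + 2) * y) * poly (pderiv (p x)) y
      + (real (card ?I) * (a + b + 2) + (g / 2) * (real (card ?I) * (real (card ?I) - 1))) * poly (p x) y)"
    have "has_bochner_integral M (\<lambda>\<omega>. T (X \<omega>)) ((g / 2) * (1 - y\<^sup>2) * poly (pderiv (pderiv q)) y
      + (b - a - (a + b + 2) * y) * poly (pderiv q) y
      + (real (card ?I) * (a + b + 2) + (g / 2) * (real (card ?I) * (real (card ?I) - 1))) * poly q y)"
      unfolding T_def by (intro has_bochner_integral_add has_bochner_integral_mult_right q)
    moreover have "expectation (\<lambda>\<omega>. T (X \<omega>)) = 0"
    proof -
      have pm: "(\<lambda>x. coeff (p x) k) \<in> borel_measurable ?L" for k
        unfolding p_def by (rule measurable_coeff_prod_linear) auto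
      note [measurable] = measurable_poly_coeff[OF pm eq_refl[OF deg(1)]]
      have T_meas: "T \<in> borel_measurable ?L"
        unfolding T_def by measurable
      have "expectation (\<lambda>\<omega>. T (X \<omega>)) = (LINT x|?L. f x * T x)"
        by (rule distributed_integral[OF dist T_meas f_nonneg, symmetric])
      also have "\<dots> = (LINT x|?L. c * (indicator ?U x * (?w x * T x)))"
        by (intro Bochner_Integration.integral_cong refl) (simp add: f)
      also have "\<dots> = 0"
        using integral_selberg_weight_jacobi_operator[OF _ g a b int, of y]
        by (simp add: T_def p_def)
      finally show ?thesis .
    qed
    ultimately show ?thesis by (simp add: has_bochner_integral_iff g_def)
  qed

  define r where "r = pcompose q [:1, 1:]"
  have pr: "poly (pderiv r) z = poly (pderiv q) (z + 1)"
    "poly (pderiv (pderiv r)) z = poly (pderiv (pderiv q)) (z + 1)" "poly r z = poly q (z + 1)" for z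
    by (simp_all add: r_def pderiv_pcompose poly_pcompose pderiv_pCons add.commute)
  have deg_q: "degree q \<le> N"
    unfolding q_def by (intro degree_sum_le) (auto intro: order_trans[OF degree_monom_le])
  have q_top: "coeff q N = 1"
    using deg(2) by (simp add: q(4) prob_space)
  then have degq: "degree q = N" using deg_q by (metis le_antisym le_degree zero_neq_one)
  have r_deg: "degree r = N" by (simp add: r_def degq degree_pcompose)
  have r_top: "coeff r N = 1"
    using lead_coeff_comp[of "[:1, 1:]" q] q_top by (simp add: r_def[symmetric] r_deg degq)
  have "- z * (z + 2) * poly (pderiv (pderiv r)) z
      - (2 * (\<alpha> + 1) + (\<alpha> + \<beta> + 2) * z) * poly (pderiv r) z
      + real N * (real N + \<alpha> + \<beta> + 1) * poly r z = 0" for z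
  proof -
    have ab: "a = k3 * (\<alpha> + 1) - 1" "b = k3 * (\<beta> + 1) - 1" using a1 b1 by auto
    have "k3 * (- z * (z + 2) * poly (pderiv (pderiv r)) z
      - (2 * (\<alpha> + 1) + (\<alpha> + \<beta> + 2) * z) * poly (pderiv r) z
      + real N * (real N + \<alpha> + \<beta> + 1) * poly r z) = 0"
      using ode[of "z + 1"] unfolding pr ab by algebra
    then show ?thesis using \<open>k3 > 0\<close> by simp
  qed
  note rec = jacobi_ode_recurrence[OF this]
  let ?j = "jacobi_coeff N \<alpha> \<beta>"
  have j_pos: "?j N > 0" by (rule jacobi_coeff_top_pos) (use \<alpha> \<beta> assms(1) in auto)
  have r_coeff: "coeff r k = ?j k / ?j N" if "k \<le> N" for k
    by (rule jacobi_ode_coeff_unique[OF \<alpha> \<beta> assms(1) r_top rec that])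
  have q_poly: "poly q y = poly (jacobi_poly N \<alpha> \<beta>) y / ?j N" for y
  proof -
    have "poly q y = poly r (y - 1)" by (simp add: pr)
    also have "\<dots> = (\<Sum>k\<le>N. ?j k / ?j N * (y - 1) ^ k)"
      by (simp add: poly_altdef r_deg r_coeff)
    finally show ?thesis by (simp add: poly_jacobi_poly_shift sum_divide_distrib)
  qed
  have q_eq: "q = smult (1 / ?j N) (jacobi_poly N \<alpha> \<beta>)"
    by (rule poly_eq_poly_eq_iff[THEN iffD1]) (simp add: fun_eq_iff q_poly)
  have lead: "lead_coeff (jacobi_poly N \<alpha> \<beta>) = ?j N"
    by (rule lead_coeff_jacobi_poly[OF assms(1) \<alpha> \<beta>])

  have "expectation (\<lambda>\<omega>. \<Prod>i=1..N. (y - X \<omega> i))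
      = 1 / lead_coeff (jacobi_poly N \<alpha> \<beta>) * poly (jacobi_poly N \<alpha> \<beta>) y" for y
    using q(1)[of y] unfolding has_bochner_integral_iff lead q_poly
    by (simp add: p_def poly_prod)
  moreover have "expectation (\<lambda>\<omega>. elem_sym N n (X \<omega>))
          = 2 ^ N / ((2 * real N + \<alpha> + \<beta>) gchoose N)
            * (\<Sum>l=N-n..N. (-1) ^ (N - l) * real (N choose l) * real (l choose (N - n))
                 * (pochhammer (real N + \<alpha> + \<beta> + 1) l * pochhammer (\<alpha> + real l + 1) (N - l)
                    / (fact N * 2 ^ l)))" if n: "n \<in> {0..N}" for n
  proof -
    have "expectation (\<lambda>\<omega>. elem_sym N n (X \<omega>)) = (-1) ^ n * coeff q (N - n)"
      using n by (simp add: elem_sym_def q(4) p_def)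
    also have "\<dots> = 1 / ?j N * (\<Sum>l=N-n..N. (-1) ^ n * ((-1) ^ (l - (N - n)) * real (l choose (N - n)) * ?j l))"
      by (simp add: q_eq coeff_jacobi_poly sum_distrib_left)
    also have "1 / ?j N = 2 ^ N / ((2 * real N + \<alpha> + \<beta>) gchoose N)"
      by (simp add: jacobi_coeff_top)
    also have "(\<Sum>l=N-n..N. (-1) ^ n * ((-1) ^ (l - (N - n)) * real (l choose (N - n)) * ?j l))
      = (\<Sum>l=N-n..N. (-1) ^ (N - l) * real (N choose l) * real (l choose (N - n))
                 * (pochhammer (real N + \<alpha> + \<beta> + 1) l * pochhammer (\<alpha> + real l + 1) (N - l)
                    / (fact N * 2 ^ l)))"
    proof (intro sum.cong refl)
      fix l assume l: "l \<in> {N - n..N}"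
      define d where "d = l - (N - n)"
      have "n = d + (N - l)" using l n by (auto simp: d_def)
      then have "(-1 :: real) ^ n * (-1) ^ (l - (N - n)) = (-1) ^ (N - l)"
        unfolding d_def[symmetric] by (simp add: power_add flip: power_mult_distrib)
      then show "(-1) ^ n * ((-1) ^ (l - (N - n)) * real (l choose (N - n)) * ?j l)
        = (-1) ^ (N - l) * real (N choose l) * real (l choose (N - n))
                 * (pochhammer (real N + \<alpha> + \<beta> + 1) l * pochhammer (\<alpha> + real l + 1) (N - l)
                    / (fact N * 2 ^ l))"
        by (simp add: jacobi_coeff_def mult.assoc[symmetric])
    qed
    finally show ?thesis .
  qed
  ultimately show ?thesis using \<alpha> \<beta> by blast
qed

end
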